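(* Assume Condition A holds, and let the $p$-order local polynomial kernel (LPK) reconstructions $\hat f_i(t)$ use a bandwidth $h$ of exact order $n^{-\delta/(2p+3)}$. Then $$\hat f_i(t)=f_i(t)+n^{-(p+1)\delta/(2p+3)}O_{\mathrm{UP}}(1),\qquad i=1,2,\dots,n.$$
   Context: Model. $\mathcal T=[a,b]$ with $-\infty<a<b<\infty$. Functional data: $y_i(t)=\eta(t)+v_i(t)+\varepsilon_i(t)$, $i=1,\dots,n$, where the $v_i$ are i.i.d. copies of a stochastic process $v$ on $\mathcal T$ with mean $0$ and covariance function $\gamma(s,t)$, the $\varepsilon_i$ are i.i.d. copies of a process with mean $0$ and covariance function $\gamma_\varepsilon(s,t)=\sigma^2(t)1_{\{s=t\}}$, and $v_i$, $\varepsilon_i$ are independent. The individual functions are $f_i(t)=\eta(t)+v_i(t)$. One observes $y_{ij}=f_i(t_{ij})+\varepsilon_{ij}$, $\varepsilon_{ij}=\varepsilon_i(t_{ij})$, at design time points $t_{ij}$, $j=1,\dots,n_i$, $i=1,\dots,n$. LPK reconstruction. $p$ is a fixed odd positive integer, $K$ a kernel, $h>0$ a bandwidth (common to all $i$), $K_h(\cdot)=K(\cdot/h)/h$. Put $\mathbf z_{ij}=[1,t_{ij}-t,\dots,(t_{ij}-t)^p]^T$, $\mathbf Z_i=[\mathbf z_{i1},\dots,\mathbf z_{in_i}]^T$, $\mathbf K_{ih}=\mathrm{diag}(K_h(t_{i1}-t),\dots,K_h(t_{in_i}-t))$, $\mathbf y_i=[y_{i1},\dots,y_{in_i}]^T$.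 Then $\hat f_i(t)=\mathbf e_{1,p+1}^T(\mathbf Z_i^T\mathbf K_{ih}\mathbf Z_i)^{-1}\mathbf Z_i^T\mathbf K_{ih}\mathbf y_i$, with $\mathbf e_{1,p+1}$ the first unit vector of $\mathbb R^{p+1}$. Notation. $O_{\mathrm{UP}}(1)$ means bounded in probability, as $n\to\infty$, uniformly for any $t$ within the interior of $\mathcal T$ and all $i=1,\dots,n$. Condition A. (1) The $t_{ij}$ are i.i.d. with p.d.f. $\pi$ with bounded support $\mathcal T$; for any $t$ in the interior of $\mathcal T$, $\pi'(t)$ exists and is continuous over $\mathcal T$. (2) For any interior points $s,t$ of $\mathcal T$: the $f_i$ and $\eta$ have up to $(p+1)$-times continuous derivatives; $\gamma(s,t)$ has up to $(p+1)$-times continuous derivatives for both $s$ and $t$; $\sigma^2$ is continuous at $t$. (3) $K$ is a bounded symmetric p.d.f. with bounded support $[-1,1]$. (4) There are constants $C,\delta>0$ with $n_i\ge Cn^\delta$ for all $i=1,\dots,n$; as $n\to\infty$, $h\to0$ and $n^\delta h\to\infty$.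
   Formalization: As stated, uniformity over the whole interior fails (e.g. η(t)=√(t−a)); it is proved uniformly on compact subsets of the interior, and on the whole interior if Condition A's regularity extends to the endpoints. The support of π is read as π>0, and the design as independent of v and ε. *)

theory Defs
  imports
    "HOL-Probability.Probability"
    "HOL-Library.Landau_Symbols"
    "Jordan_Normal_Form.Gauss_Jordan_Elimination"
begin

section \<open>Functional data\<close>

text \<open>
  Individuals are numbered \<open>i = 0, 1, 2, \<dots>\<close> and the observations on an individual
  \<open>j = 0, 1, 2, \<dots>\<close>; at stage \<open>n\<close> the individuals \<open>i < n\<close> are observed. A stochastic
  process on \<open>T\<close> is a family \<open>X t \<omega>\<close>; its law is the distribution of the random element
  \<open>sample_path T X\<close> of the product space \<open>path_space T\<close>.
\<close>

abbreviation path_space :: "real set \<Rightarrow> (real \<Rightarrow> real) measure" where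
  "path_space T \<equiv> Pi\<^sub>M T (\<lambda>_. borel)"

definition sample_path :: "real set \<Rightarrow> (real \<Rightarrow> 'w \<Rightarrow> real) \<Rightarrow> 'w \<Rightarrow> real \<Rightarrow> real" where
  "sample_path T X \<omega> = (\<lambda>t\<in>T. X t \<omega>)"

definition centered_process_with_cov ::
    "'w measure \<Rightarrow> real set \<Rightarrow> (real \<Rightarrow> 'w \<Rightarrow> real) \<Rightarrow> (real \<Rightarrow> real \<Rightarrow> real) \<Rightarrow> bool" where
  "centered_process_with_cov M T X \<kappa> \<longleftrightarrow>
     (\<forall>t\<in>T. X t \<in> borel_measurable M \<and> integrable M (\<lambda>\<omega>. (X t \<omega>)\<^sup>2)
            \<and> integral\<^sup>L M (X t) = 0) \<and>
     (\<forall>s\<in>T. \<forall>t\<in>T. integral\<^sup>L M (\<lambda>\<omega>. X s \<omega> * X t \<omega>) = \<kappa> s t)"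

definition identically_distributed ::
    "'w measure \<Rightarrow> real set \<Rightarrow> (nat \<Rightarrow> real \<Rightarrow> 'w \<Rightarrow> real) \<Rightarrow> bool" where
  "identically_distributed M T X \<longleftrightarrow>
     (\<forall>i k. distr M (path_space T) (sample_path T (X i))
          = distr M (path_space T) (sample_path T (X k)))"

definition noise_cov :: "(real \<Rightarrow> real) \<Rightarrow> real \<Rightarrow> real \<Rightarrow> real" where
  "noise_cov \<sigma>2 s t = (if s = t then \<sigma>2 t else 0)"

text \<open>
  All the processes \<open>v\<^sub>0, v\<^sub>1, \<dots>, \<epsilon>\<^sub>0, \<epsilon>\<^sub>1, \<dots>\<close>, indexed by \<open>nat + nat\<close>, are mutually independent.
\<close>

definition functional_data_model ::
    "'w measure \<Rightarrow> real set \<Rightarrow> (nat \<Rightarrow> real \<Rightarrow> 'w \<Rightarrow> real) \<Rightarrow> (real \<Rightarrow> real \<Rightarrow> real)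
       \<Rightarrow> (nat \<Rightarrow> real \<Rightarrow> 'w \<Rightarrow> real) \<Rightarrow> (real \<Rightarrow> real) \<Rightarrow> bool" where
  "functional_data_model M T v \<gamma> \<epsilon> \<sigma>2 \<longleftrightarrow>
     (\<forall>i. centered_process_with_cov M T (v i) \<gamma>) \<and>
     (\<forall>i. centered_process_with_cov M T (\<epsilon> i) (noise_cov \<sigma>2)) \<and>
     identically_distributed M T v \<and>
     identically_distributed M T \<epsilon> \<and>
     prob_space.indep_vars M (\<lambda>_. path_space T)
       (case_sum (\<lambda>i. sample_path T (v i)) (\<lambda>i. sample_path T (\<epsilon> i))) UNIV"


section \<open>Random design\<close>

text \<open>
  \<open>N n i\<close> is the number of observations on individual \<open>i\<close> at stage \<open>n\<close>, and \<open>\<tau> n i j\<close> the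
  \<open>j\<close>-th design time point. The design may be a triangular array; a design not depending on \<open>n\<close>
  is a special case.
\<close>

definition design_index :: "(nat \<Rightarrow> nat \<Rightarrow> nat) \<Rightarrow> nat \<Rightarrow> (nat \<times> nat) set" where
  "design_index N n = (SIGMA i:{..<n}. {..<N n i})"

abbreviation design_space :: "(nat \<Rightarrow> nat \<Rightarrow> nat) \<Rightarrow> nat \<Rightarrow> (nat \<times> nat \<Rightarrow> real) measure" where
  "design_space N n \<equiv> Pi\<^sub>M (design_index N n) (\<lambda>_. borel)"

definition design ::
    "(nat \<Rightarrow> nat \<Rightarrow> nat) \<Rightarrow> (nat \<Rightarrow> nat \<Rightarrow> nat \<Rightarrow> 'w \<Rightarrow> real) \<Rightarrow> nat \<Rightarrow> 'w \<Rightarrow> nat \<times> nat \<Rightarrow> real" where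
  "design N \<tau> n \<omega> = (\<lambda>(i, j)\<in>design_index N n. \<tau> n i j \<omega>)"

definition design_algebra ::
    "'w measure \<Rightarrow> (nat \<Rightarrow> nat \<Rightarrow> nat) \<Rightarrow> (nat \<Rightarrow> nat \<Rightarrow> nat \<Rightarrow> 'w \<Rightarrow> real) \<Rightarrow> nat \<Rightarrow> 'w measure" where
  "design_algebra M N \<tau> n = vimage_algebra (space M) (design N \<tau> n) (design_space N n)"

definition process_algebra ::
    "'w measure \<Rightarrow> real set \<Rightarrow> (nat \<Rightarrow> real \<Rightarrow> 'w \<Rightarrow> real) \<Rightarrow> (nat \<Rightarrow> real \<Rightarrow> 'w \<Rightarrow> real)
       \<Rightarrow> 'w measure" where
  "process_algebra M T v \<epsilon> =
     vimage_algebra (space M)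
       (\<lambda>\<omega>. case_sum (\<lambda>i. sample_path T (v i) \<omega>) (\<lambda>i. sample_path T (\<epsilon> i) \<omega>))
       (Pi\<^sub>M UNIV (\<lambda>_. path_space T))"

definition iid_design ::
    "'w measure \<Rightarrow> (real \<Rightarrow> real) \<Rightarrow> (nat \<Rightarrow> nat \<Rightarrow> nat)
       \<Rightarrow> (nat \<Rightarrow> nat \<Rightarrow> nat \<Rightarrow> 'w \<Rightarrow> real) \<Rightarrow> bool" where
  "iid_design M \<pi> N \<tau> \<longleftrightarrow>
     (\<forall>n. prob_space.indep_vars M (\<lambda>_. borel) (\<lambda>(i, j). \<tau> n i j) (design_index N n) \<and>
          (\<forall>(i, j)\<in>design_index N n. distributed M lborel (\<tau> n i j) (\<lambda>x. ennreal (\<pi> x))))"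

text \<open>
  The design is independent of the processes, and the sampled errors \<open>\<epsilon>\<^sub>i\<^sub>j = \<epsilon>\<^sub>i(t\<^sub>i\<^sub>j)\<close> have, given
  the design, mean \<open>0\<close> and the covariances that \<open>\<epsilon>\<^sub>i\<close> has at the design points. The last clauses do
  not follow from independence on the product space: \<open>\<epsilon>\<^sub>i\<close> is white noise in continuous time,
  hence has no jointly measurable version unless it is degenerate, and its finite-dimensional
  distributions do not determine its values at random times. For the same reason only the sampled
  variables, and not the map \<open>(t, \<omega>) \<mapsto> \<epsilon>\<^sub>i(t)\<close>, are required to be measurable. Second moments use
  \<open>nn_cond_exp\<close>, since \<open>\<sigma>2\<close> composed with a design point need not be integrable (\<open>real_cond_exp\<close>
  would turn an infinite conditional moment into \<open>0\<close>).
\<close>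

definition design_independent_of_processes ::
    "'w measure \<Rightarrow> real set \<Rightarrow> (real \<Rightarrow> real) \<Rightarrow> (nat \<Rightarrow> real \<Rightarrow> 'w \<Rightarrow> real)
       \<Rightarrow> (nat \<Rightarrow> real \<Rightarrow> 'w \<Rightarrow> real) \<Rightarrow> (real \<Rightarrow> real) \<Rightarrow> (nat \<Rightarrow> nat \<Rightarrow> nat) \<Rightarrow> (nat \<Rightarrow> nat \<Rightarrow> nat \<Rightarrow> 'w \<Rightarrow> real) \<Rightarrow> bool" where
  "design_independent_of_processes M T \<eta> v \<epsilon> \<sigma>2 N \<tau> \<longleftrightarrow>
     (\<forall>n. prob_space.indep_set M
            (sets (process_algebra M T v \<epsilon>)) (sets (design_algebra M N \<tau> n))) \<and>
     (\<forall>n. \<forall>(i, j)\<in>design_index N n.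
        (\<lambda>\<omega>. \<eta> (\<tau> n i j \<omega>) + v i (\<tau> n i j \<omega>) \<omega>) \<in> borel_measurable M \<and>
        (\<lambda>\<omega>. \<epsilon> i (\<tau> n i j \<omega>) \<omega>) \<in> borel_measurable M) \<and>
     (\<forall>n. \<forall>(i, j)\<in>design_index N n.
        (AE \<omega> in M. real_cond_exp M (design_algebra M N \<tau> n)
                      (\<lambda>\<omega>. \<epsilon> i (\<tau> n i j \<omega>) \<omega>) \<omega> = 0) \<and>
        (AE \<omega> in M. nn_cond_exp M (design_algebra M N \<tau> n)
                      (\<lambda>\<omega>. ennreal ((\<epsilon> i (\<tau> n i j \<omega>) \<omega>)\<^sup>2)) \<omega>
                    = ennreal (noise_cov \<sigma>2 (\<tau> n i j \<omega>) (\<tau> n i j \<omega>))) \<and>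
        (\<forall>k<N n i. k \<noteq> j \<longrightarrow>
           (AE \<omega> in M. real_cond_exp M (design_algebra M N \<tau> n)
                         (\<lambda>\<omega>. \<epsilon> i (\<tau> n i j \<omega>) \<omega> * \<epsilon> i (\<tau> n i k \<omega>) \<omega>) \<omega>
                       = noise_cov \<sigma>2 (\<tau> n i j \<omega>) (\<tau> n i k \<omega>))))"


section \<open>Regularity conditions\<close>

text \<open>
  The regularity conditions refer to a set \<open>R\<close> of time points, which is the open interval
  \<open>{a<..<b}\<close>, or \<open>{a..b}\<close> with one-sided derivatives at the endpoints.
\<close>

definition times_cont_diff_on :: "nat \<Rightarrow> real set \<Rightarrow> (real \<Rightarrow> real) \<Rightarrow> bool" where
  "times_cont_diff_on k R f \<longleftrightarrow>
     (\<exists>D :: nat \<Rightarrow> real \<Rightarrow> real. (\<forall>t\<in>R. D 0 t = f t) \<and>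
        (\<forall>l<k. \<forall>t\<in>R. (D l has_real_derivative D (Suc l) t) (at t within R)) \<and>
        (\<forall>l\<le>k. continuous_on R (D l)))"

definition partials_cont_diff_on :: "nat \<Rightarrow> real set \<Rightarrow> (real \<Rightarrow> real \<Rightarrow> real) \<Rightarrow> bool" where
  "partials_cont_diff_on k R g \<longleftrightarrow>
     (\<exists>D1 D2 :: nat \<Rightarrow> real \<Rightarrow> real \<Rightarrow> real.
        (\<forall>s\<in>R. \<forall>t\<in>R. D1 0 s t = g s t \<and> D2 0 s t = g s t) \<and>
        (\<forall>l<k. \<forall>s\<in>R. \<forall>t\<in>R.
           ((\<lambda>x. D1 l x t) has_real_derivative D1 (Suc l) s t) (at s within R) \<and>
           ((\<lambda>x. D2 l s x) has_real_derivative D2 (Suc l) s t) (at t within R)) \<and>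
        (\<forall>l\<le>k. continuous_on (R \<times> R) (\<lambda>(s, t). D1 l s t) \<and>
                continuous_on (R \<times> R) (\<lambda>(s, t). D2 l s t)))"

definition is_pdf :: "(real \<Rightarrow> real) \<Rightarrow> bool" where
  "is_pdf g \<longleftrightarrow> g \<in> borel_measurable borel \<and> (\<forall>x. 0 \<le> g x) \<and>
     (\<integral>\<^sup>+ x. ennreal (g x) \<partial>lborel) = 1"

text \<open>
  ``Support'' of the design density is positivity: at a zero of \<open>\<pi>\<close> there are too few design points
  nearby for the stated rate.
\<close>

definition regular_design_density :: "real \<Rightarrow> real \<Rightarrow> real set \<Rightarrow> (real \<Rightarrow> real) \<Rightarrow> bool" where
  "regular_design_density a b R \<pi> \<longleftrightarrow>
     is_pdf \<pi> \<and> (\<forall>t. t \<notin> {a..b} \<longrightarrow> \<pi> t = 0) \<and> (\<forall>t\<in>R. 0 < \<pi> t) \<and>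
     (\<exists>\<pi>'. continuous_on {a..b} \<pi>' \<and>
           (\<forall>t\<in>R. (\<pi> has_real_derivative \<pi>' t) (at t within {a..b})))"

definition smooth_functional_data ::
    "'w measure \<Rightarrow> nat \<Rightarrow> real \<Rightarrow> real \<Rightarrow> real set \<Rightarrow> (real \<Rightarrow> real) \<Rightarrow> (nat \<Rightarrow> real \<Rightarrow> 'w \<Rightarrow> real)
       \<Rightarrow> (real \<Rightarrow> real \<Rightarrow> real) \<Rightarrow> (real \<Rightarrow> real) \<Rightarrow> bool" where
  "smooth_functional_data M p a b R \<eta> v \<gamma> \<sigma>2 \<longleftrightarrow>
     times_cont_diff_on (p + 1) R \<eta> \<and>
     (\<forall>i. AE \<omega> in M. times_cont_diff_on (p + 1) R (\<lambda>t. \<eta> t + v i t \<omega>)) \<and>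
     partials_cont_diff_on (p + 1) R \<gamma> \<and>
     (\<forall>t\<in>R. continuous (at t within {a..b}) \<sigma>2)"

definition kernel_condition :: "(real \<Rightarrow> real) \<Rightarrow> bool" where
  "kernel_condition K \<longleftrightarrow>
     is_pdf K \<and> (\<exists>B. \<forall>x. K x \<le> B) \<and> (\<forall>x. K (- x) = K x) \<and> closure {x. K x \<noteq> 0} = {-1..1}"

definition sampling_condition ::
    "real \<Rightarrow> real \<Rightarrow> (nat \<Rightarrow> nat \<Rightarrow> nat) \<Rightarrow> (nat \<Rightarrow> real) \<Rightarrow> bool" where
  "sampling_condition C \<delta> N h \<longleftrightarrow>
     0 < C \<and> 0 < \<delta> \<and> (\<forall>n. \<forall>i<n. C * real n powr \<delta> \<le> real (N n i)) \<and>
     (\<forall>n. 0 < h n) \<and> h \<longlonglongrightarrow> 0 \<and>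
     filterlim (\<lambda>n. real n powr \<delta> * h n) at_top sequentially"


section \<open>Local polynomial kernel reconstruction\<close>

text \<open>
  \<open>x j\<close> and \<open>y j\<close> for \<open>j < m\<close> are the design points and the responses of one individual. The value
  is set to \<open>0\<close> if the matrix \<open>Z\<^sup>T K\<^sub>h Z\<close> is singular.
\<close>

definition lpk_basis_matrix :: "nat \<Rightarrow> nat \<Rightarrow> (nat \<Rightarrow> real) \<Rightarrow> real \<Rightarrow> real mat" where
  "lpk_basis_matrix p m x t = Matrix.mat m (p + 1) (\<lambda>(j, k). (x j - t) ^ k)"

definition lpk_weight_matrix ::
    "(real \<Rightarrow> real) \<Rightarrow> real \<Rightarrow> nat \<Rightarrow> (nat \<Rightarrow> real) \<Rightarrow> real \<Rightarrow> real mat" where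
  "lpk_weight_matrix K h m x t = mat_diag m (\<lambda>j. K ((x j - t) / h) / h)"

definition lpk ::
    "nat \<Rightarrow> (real \<Rightarrow> real) \<Rightarrow> real \<Rightarrow> nat \<Rightarrow> (nat \<Rightarrow> real) \<Rightarrow> (nat \<Rightarrow> real) \<Rightarrow> real \<Rightarrow> real" where
  "lpk p K h m x y t =
     (let Z = lpk_basis_matrix p m x t;
          W = lpk_weight_matrix K h m x t
      in case mat_inverse (transpose_mat Z * W * Z) of
           None \<Rightarrow> 0
         | Some G \<Rightarrow> scalar_prod (unit_vec (p + 1) 0)
                       ((G * transpose_mat Z * W) *\<^sub>v Matrix.vec m y))"

definition lpk_reconstruction ::
    "nat \<Rightarrow> (real \<Rightarrow> real) \<Rightarrow> (nat \<Rightarrow> real) \<Rightarrow> (nat \<Rightarrow> nat \<Rightarrow> nat)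
       \<Rightarrow> (nat \<Rightarrow> nat \<Rightarrow> nat \<Rightarrow> 'w \<Rightarrow> real) \<Rightarrow> (real \<Rightarrow> real)
       \<Rightarrow> (nat \<Rightarrow> real \<Rightarrow> 'w \<Rightarrow> real) \<Rightarrow> (nat \<Rightarrow> real \<Rightarrow> 'w \<Rightarrow> real)
       \<Rightarrow> nat \<Rightarrow> nat \<Rightarrow> real \<Rightarrow> 'w \<Rightarrow> real" where
  "lpk_reconstruction p K h N \<tau> \<eta> v \<epsilon> n i t \<omega> =
     lpk p K (h n) (N n i) (\<lambda>j. \<tau> n i j \<omega>)
       (\<lambda>j. \<eta> (\<tau> n i j \<omega>) + v i (\<tau> n i j \<omega>) \<omega> + \<epsilon> i (\<tau> n i j \<omega>) \<omega>) t"


section \<open>Uniform boundedness in probability\<close>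

text \<open>
  The random variables \<open>X n i t\<close>, \<open>i < n\<close>, \<open>t \<in> S\<close>, are bounded in probability as \<open>n \<rightarrow> \<infinity>\<close>, with
  bounds not depending on \<open>i\<close> and \<open>t\<close> (uniform tightness; the supremum over \<open>i\<close> and \<open>t\<close> is outside
  the probability). Measurability is included so that the probabilities are meaningful.
\<close>

definition O_UP_one :: "'w measure \<Rightarrow> real set \<Rightarrow> (nat \<Rightarrow> nat \<Rightarrow> real \<Rightarrow> 'w \<Rightarrow> real) \<Rightarrow> bool" where
  "O_UP_one M S X \<longleftrightarrow>
     (\<forall>n. \<forall>i<n. \<forall>t\<in>S. X n i t \<in> borel_measurable M) \<and>
     (\<forall>e>0. \<exists>B. \<forall>\<^sub>F n in sequentially. \<forall>i<n. \<forall>t\<in>S.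
        measure M {\<omega> \<in> space M. \<bar>X n i t \<omega>\<bar> > B} \<le> e)"

text \<open>\<open>F n i t = f i t + r n \<sqdot> O\<^sub>U\<^sub>P(1)\<close>, uniformly in \<open>t \<in> S\<close> and \<open>i < n\<close>.\<close>

definition expansion_O_UP ::
    "'w measure \<Rightarrow> real set \<Rightarrow> (nat \<Rightarrow> nat \<Rightarrow> real \<Rightarrow> 'w \<Rightarrow> real) \<Rightarrow> (nat \<Rightarrow> real \<Rightarrow> 'w \<Rightarrow> real)
       \<Rightarrow> (nat \<Rightarrow> real) \<Rightarrow> bool" where
  "expansion_O_UP M S F f r \<longleftrightarrow>
     (\<exists>X. O_UP_one M S X \<and>
          (\<forall>n. \<forall>i<n. \<forall>t\<in>S. \<forall>\<omega>\<in>space M. F n i t \<omega> = f i t \<omega> + r n * X n i t \<omega>))"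

end

theory Submission
  imports Defs "Jordan_Normal_Form.Determinant"
begin

text \<open>
  For a given design the reconstruction at \<open>t\<close> is a weighted sum of the responses, and the weights
  reproduce polynomials of degree at most \<open>p\<close> (\<open>lpk_weights_reproduce_polynomials\<close>). Subtracting the
  Taylor polynomial of the individual function \<open>f\<close> at \<open>t\<close> therefore splits the error into the smoothed Taylor
  remainder and the smoothed noise (\<open>lpk_error_decomposition\<close>). If \<open>m\<close> is the number of design points, the
  weights are of size \<open>O(1 / (m h))\<close> and supported on a window that contains \<open>O(m h)\<close> of them. So
  the first part is of order \<open>h\<^sup>p\<^sup>+\<^sup>1\<close>, and the second part, a sum of terms that are uncorrelated given the
  design, has second moment of order \<open>1 / (m h)\<close> (\<open>weighted_noise_tail\<close>). For the bandwidth of the theorem both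
  parts are of the stated order (\<open>sampling_rates\<close>).

  The size of the weights rests on a lower bound for the rescaled Gram matrix that holds for all \<open>t\<close>, all
  individuals and all small bandwidths. The entries of this matrix are averages of independent
  terms, which concentrate around their means (\<open>local_moment_concentration\<close>). The matrix of the means is
  bounded below because the density is bounded below on at least one half of the window, and on either
  half the kernel has mass that no nonzero polynomial can avoid (\<open>kernel_half_form_coercive\<close>).
  Working with half windows makes the estimate uniform up to the endpoints of the design interval.

  The Taylor remainder involves a random derivative of order \<open>p + 1\<close>. It is continuous, hence bounded
  on compact intervals, and the bound can be taken the same for all individuals because they are identically
  distributed; the work lies in expressing the bound as a measurable property of the sample path
  (\<open>uniform_Taylor_bound\<close>). Boundedness in probability needs no more than a bound on an event of
  probability close to one.

  Both assertions of the theorem are instances of one statement about an interval \<open>{c..d}\<close> on which all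
  regularity conditions hold (\<open>lpk_expansion_of_regularity\<close>): a compact neighborhood of \<open>S\<close> in the first
  case, and the whole interval \<open>{a..b}\<close> in the second.
\<close>


section \<open>Polynomial forms weighted by a kernel\<close>

text \<open>
  The form is continuous in the coefficient vector, and it is positive away from the origin: a nonzero
  polynomial has finitely many roots, so it cannot vanish almost everywhere where the weight is positive.
  Compactness of the unit sphere gives a positive minimum, and homogeneity extends it to all vectors.
\<close>

lemma weighted_polynomial_form_coercive:
  fixes w :: "real \<Rightarrow> real"
  assumes w[measurable]: "w \<in> borel_measurable borel"
    and w0: "\<And>u. 0 \<le> w u" and wB: "\<And>u. w u \<le> B"
    and supp: "\<And>u. u \<notin> {-1..1} \<Longrightarrow> w u = 0"
    and pos: "\<not> (AE u in lborel. w u = 0)"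
  shows "\<exists>c>0. \<forall>q. c * (\<Sum>k\<le>p. (q k)\<^sup>2) \<le> (\<integral>u. w u * (\<Sum>k\<le>p. q k * u ^ k)\<^sup>2 \<partial>lborel)"
proof -
  have B0: "0 \<le> B" using w0[of 0] wB[of 0] by linarith
  have intb: "integrable lborel (\<lambda>u. w u * g u)" if "continuous_on UNIV g" for g :: "real \<Rightarrow> real"
  proof -
    have [measurable]: "g \<in> borel_measurable borel"
      using that by (rule borel_measurable_continuous_onI)
    have "continuous_on {-1..1::real} g" using that continuous_on_subset by blast
    then have "set_integrable lborel {-1..1} g" by (rule borel_integrable_atLeastAtMost')
    then have "integrable lborel (\<lambda>u. B * (indicator {-1..1} u * g u))"
      unfolding set_integrable_def by simp
    then show ?thesis
    proof (rule Bochner_Integration.integrable_bound)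
      show "AE u in lborel. norm (w u * g u) \<le> norm (B * (indicator {- 1..1} u * g u))"
      proof (rule AE_I2)
        fix u
        show "norm (w u * g u) \<le> norm (B * (indicator {- 1..1} u * g u))"
          using w0[of u] wB[of u] supp[of u] B0
          by (auto simp: indicator_def abs_mult intro!: mult_right_mono)
      qed
    qed simp
  qed
  define Q where "Q q = (\<integral>u. w u * (\<Sum>k\<le>p. q k * u ^ k)\<^sup>2 \<partial>lborel)" for q :: "nat \<Rightarrow> real"
  define \<mu> where "\<mu> s = (\<integral>u. w u * u ^ s \<partial>lborel)" for s
  have Q_exp: "Q q = (\<Sum>k\<le>p. \<Sum>l\<le>p. q k * q l * \<mu> (k + l))" for q
  proof -
    have "w u * (\<Sum>k\<le>p. q k * u ^ k)\<^sup>2 = (\<Sum>k\<le>p. \<Sum>l\<le>p. q k * q l * (w u * u ^ (k + l)))" for u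
      by (simp add: power2_eq_square sum_product sum_distrib_left power_add algebra_simps)
    then show ?thesis unfolding Q_def \<mu>_def
      by (simp add: Bochner_Integration.integral_sum Bochner_Integration.integrable_sum intb continuous_intros)
  qed
  have Q_cont: "continuous_on A Q" for A
    unfolding Q_exp[abs_def]
    by (intro continuous_intros continuous_on_subset[OF continuous_on_product_coordinates]) auto
  \<comment> \<open>Coefficient vectors are functions on the naturals with the product topology, in which a product of
      compact factors is compact; the unit sphere is a closed part of such a product.\<close>
  define S where "S = {q :: nat \<Rightarrow> real. (\<forall>k. k > p \<longrightarrow> q k = 0) \<and> (\<Sum>k\<le>p. (q k)\<^sup>2) = 1}"
  define P where "P = (\<Pi>\<^sub>E k\<in>(UNIV :: nat set). if k \<le> p then {-1..1::real} else {0})"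
  have "compactin (product_topology (\<lambda>i. euclidean) UNIV) P"
    unfolding P_def by (subst compactin_PiE) auto
  then have "compact P" by (simp add: euclidean_product_topology)
  moreover have "closed {q :: nat \<Rightarrow> real. (\<Sum>k\<le>p. (q k)\<^sup>2) = 1}"
    by (rule closed_Collect_eq) (intro continuous_intros, auto)+
  ultimately have "compact (P \<inter> {q. (\<Sum>k\<le>p. (q k)\<^sup>2) = 1})" by (rule compact_Int_closed)
  moreover have "S = P \<inter> {q. (\<Sum>k\<le>p. (q k)\<^sup>2) = 1}"
  proof -
    have "q k \<in> {-1..1}" if "(\<Sum>k\<le>p. (q k)\<^sup>2) = 1" "k \<le> p" for q :: "nat \<Rightarrow> real" and k
    proof -
      have "(q k)\<^sup>2 \<le> (\<Sum>k\<le>p. (q k)\<^sup>2)" by (rule member_le_sum) (use that in auto)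
      then have "\<bar>q k\<bar> \<le> 1" using that by (simp add: abs_square_le_1)
      then show ?thesis by auto
    qed
    then show ?thesis unfolding S_def P_def by (auto simp: PiE_iff Ball_def split: if_splits)
  qed
  ultimately have cS: "compact S" by simp
  have Sne: "S \<noteq> {}"
  proof -
    have "(\<Sum>k\<le>p. (if k = 0 then 1 else 0 :: real)\<^sup>2) = (\<Sum>k\<le>p. if k = 0 then 1 else 0)"
      by (rule sum.cong) auto
    then have "(\<lambda>k. if k = 0 then 1 else 0) \<in> S"
      unfolding S_def by simp
    then show ?thesis by auto
  qed
  obtain q0 where q0: "q0 \<in> S" and min: "\<And>q. q \<in> S \<Longrightarrow> Q q0 \<le> Q q"
    using continuous_attains_inf[OF cS Sne Q_cont] by auto
  have "Q q0 > 0"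
  proof (rule ccontr)
    assume "\<not> 0 < Q q0"
    then have "Q q0 \<le> 0" by simp
    have nn: "0 \<le> w u * (\<Sum>k\<le>p. q0 k * u ^ k)\<^sup>2" for u using w0 by simp
    have "0 \<le> Q q0" unfolding Q_def by (rule Bochner_Integration.integral_nonneg) (rule nn)
    with \<open>Q q0 \<le> 0\<close> have "Q q0 = 0" by simp
    moreover have "integrable lborel (\<lambda>u. w u * (\<Sum>k\<le>p. q0 k * u ^ k)\<^sup>2)"
      by (rule intb) (intro continuous_intros)
    ultimately have "AE u in lborel. w u * (\<Sum>k\<le>p. q0 k * u ^ k)\<^sup>2 = 0"
      unfolding Q_def using integral_nonneg_eq_0_iff_AE nn by blast
    moreover have "\<exists>k\<le>p. q0 k \<noteq> 0"
    proof (rule ccontr)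
      assume "\<not> ?thesis"
      then have "(\<Sum>k\<le>p. (q0 k)\<^sup>2) = 0" by simp
      then show False using q0 by (simp add: S_def)
    qed
    then have "finite {u. (\<Sum>k\<le>p. q0 k * u ^ k) = 0}" 
      using polyfun_finite_roots[of q0 p] by auto
    then have "AE u in lborel. (\<Sum>k\<le>p. q0 k * u ^ k) \<noteq> 0"
      by (intro AE_I'[OF finite_imp_null_set_lborel]) auto
    ultimately have "AE u in lborel. w u = 0" by eventually_elim auto
    with pos show False by blast
  qed
  have "Q q0 * (\<Sum>k\<le>p. (q k)\<^sup>2) \<le> Q q" for q
  proof -
    define r where "r = (\<Sum>k\<le>p. (q k)\<^sup>2)"
    show ?thesis
    proof (cases "r = 0")
      case True
      then show ?thesis unfolding r_def[symmetric]
        by (simp add: Q_def Bochner_Integration.integral_nonneg w0)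
    next
      case False
      moreover have "r \<ge> 0" unfolding r_def by (intro sum_nonneg) auto
      ultimately have r: "r > 0" by simp
      define q' where "q' k = (if k \<le> p then q k / sqrt r else 0)" for k
      have "(\<Sum>k\<le>p. (q' k)\<^sup>2) = (\<Sum>k\<le>p. (q k)\<^sup>2 / r)"
        by (rule sum.cong) (use r in \<open>auto simp: q'_def power_divide\<close>)
      also have "\<dots> = 1" using r by (simp add: r_def sum_divide_distrib[symmetric])
      finally have "q' \<in> S" by (auto simp: S_def q'_def)
      then have "Q q0 \<le> Q q'" by (rule min)
      also have "Q q' = (\<Sum>k\<le>p. \<Sum>l\<le>p. q k * q l * \<mu> (k + l) / r)"
        unfolding Q_exp by (intro sum.cong refl) (use r in \<open>auto simp: q'_def field_simps\<close>)
      also have "\<dots> = Q q / r" unfolding Q_exp by (simp add: sum_divide_distrib)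
      finally show ?thesis using r unfolding r_def[symmetric] by (simp add: field_simps)
    qed
  qed
  with \<open>Q q0 > 0\<close> show ?thesis unfolding Q_def by blast
qed

lemma kernel_vanishes_outside:
  assumes "kernel_condition K" "u \<notin> {-1..1}"
  shows "K u = 0"
  using assms closure_subset[of "{x. K x \<noteq> 0}"] unfolding kernel_condition_def by blast

text \<open>
  Close to an endpoint of the design interval only one half of the window contains design points. Hence
  each half of the kernel has to control all polynomials by itself; it does, because symmetry gives both
  halves the same positive mass.
\<close>

lemma kernel_half_form_coercive:
  assumes K: "kernel_condition K"
  obtains c where "c > 0"
    "\<And>q I. I \<in> {{0..1}, {-1..0}} \<Longrightarrow>
       c * (\<Sum>k\<le>p. (q k)\<^sup>2) \<le> (\<integral>u. indicator I u * K u * (\<Sum>k\<le>p. q k * u ^ k)\<^sup>2 \<partial>lborel)"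
proof -
  from K obtain B where [measurable]: "K \<in> borel_measurable borel" and K0: "\<And>u. 0 \<le> K u" and
    KB: "\<And>u. K u \<le> B" and sym: "\<And>u. K (- u) = K u" and K1: "(\<integral>\<^sup>+ x. ennreal (K x) \<partial>lborel) = 1"
    unfolding kernel_condition_def is_pdf_def by blast
  have KB': "indicator I u * K u \<le> B" for I u
    using KB[of u] K0[of u] by (auto simp: indicator_def)
  have nn: "\<not> (AE u in lborel. K u = 0)"
  proof
    assume "AE u in lborel. K u = 0"
    then have "(\<integral>\<^sup>+ x. ennreal (K x) \<partial>lborel) = 0"
      by (subst nn_integral_0_iff_AE) auto
    with K1 show False by simp
  qed
  have AE_iff: "(AE u in lborel. indicator I u * K u = 0)
      \<longleftrightarrow> (\<integral>\<^sup>+ u. ennreal (indicator I u * K u) \<partial>lborel) = 0" if "I \<in> sets borel" for I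
    using that K0 by (subst nn_integral_0_iff_AE) (auto simp: indicator_def)
  have "(\<integral>\<^sup>+ u. ennreal (indicator {-1..0::real} u * K u) \<partial>lborel)
      = (\<integral>\<^sup>+ u. ennreal (indicator {0..1::real} u * K u) \<partial>lborel)"
    by (subst nn_integral_real_affine[where c = "-1" and t = 0])
       (auto intro!: nn_integral_cong simp: sym indicator_def)
  then have mirror: "(AE u in lborel. indicator {-1..0::real} u * K u = 0)
      \<longleftrightarrow> (AE u in lborel. indicator {0..1::real} u * K u = 0)"
    by (simp only: AE_iff[OF borel_closed[OF closed_atLeastAtMost]])
  have both: False
    if "AE u in lborel. indicator {0..1::real} u * K u = 0" "AE u in lborel. indicator {-1..0::real} u * K u = 0"
  proof -
    from that have "AE u in lborel. K u = 0"
      by eventually_elim (use kernel_vanishes_outside[OF K] in \<open>fastforce simp: indicator_def split: if_splits\<close>)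
    with nn show False ..
  qed
  have c: "\<exists>c>0. \<forall>q. c * (\<Sum>k\<le>p. (q k)\<^sup>2) \<le> (\<integral>u. indicator I u * K u * (\<Sum>k\<le>p. q k * u ^ k)\<^sup>2 \<partial>lborel)"
    if "I \<in> {{0..1}, {-1..0}}" for I
  proof (rule weighted_polynomial_form_coercive)
    show "(\<lambda>u. indicator I u * K u) \<in> borel_measurable borel" using that by auto
    show "\<not> (AE u in lborel. indicator I u * K u = 0)" using that mirror both by blast
  qed (use K0 KB' kernel_vanishes_outside[OF K] in auto)
  obtain c1 where "c1 > 0" and c1: "\<And>q. c1 * (\<Sum>k\<le>p. (q k)\<^sup>2) \<le> (\<integral>u. indicator {0..1} u * K u * (\<Sum>k\<le>p. q k * u ^ k)\<^sup>2 \<partial>lborel)"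
    using c[of "{0..1}"] by auto
  obtain c2 where "c2 > 0" and c2: "\<And>q. c2 * (\<Sum>k\<le>p. (q k)\<^sup>2) \<le> (\<integral>u. indicator {-1..0} u * K u * (\<Sum>k\<le>p. q k * u ^ k)\<^sup>2 \<partial>lborel)"
    using c[of "{-1..0}"] by auto
  show thesis
  proof (rule that[of "min c1 c2"])
    show "min c1 c2 > 0" using \<open>c1 > 0\<close> \<open>c2 > 0\<close> by simp
    fix q :: "nat \<Rightarrow> real" and I :: "real set" assume I: "I \<in> {{0..1}, {-1..0}}"
    have "min c1 c2 * (\<Sum>k\<le>p. (q k)\<^sup>2) \<le> c1 * (\<Sum>k\<le>p. (q k)\<^sup>2)"
      "min c1 c2 * (\<Sum>k\<le>p. (q k)\<^sup>2) \<le> c2 * (\<Sum>k\<le>p. (q k)\<^sup>2)"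
      by (intro mult_right_mono sum_nonneg; simp)+
    with c1[of q] c2[of q] I
    show "min c1 c2 * (\<Sum>k\<le>p. (q k)\<^sup>2) \<le> (\<integral>u. indicator I u * K u * (\<Sum>k\<le>p. q k * u ^ k)\<^sup>2 \<partial>lborel)"
      by auto
  qed
qed

section \<open>Weights of the local polynomial smoother\<close>

definition lpk_gram :: "nat \<Rightarrow> (real \<Rightarrow> real) \<Rightarrow> real \<Rightarrow> nat \<Rightarrow> (nat \<Rightarrow> real) \<Rightarrow> real \<Rightarrow> real mat" where
  "lpk_gram p K h m x t =
     Matrix.mat (p + 1) (p + 1) (\<lambda>(k, l). \<Sum>j<m. K ((x j - t) / h) / h * (x j - t) ^ (k + l))"

lemma lpk_gram_carrier: "lpk_gram p K h m x t \<in> carrier_mat (p + 1) (p + 1)"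
  by (simp add: lpk_gram_def)

lemma lpk_gram_index [simp]:
  "k \<le> p \<Longrightarrow> l \<le> p \<Longrightarrow>
     lpk_gram p K h m x t $$ (k, l) = (\<Sum>j<m. K ((x j - t) / h) / h * (x j - t) ^ (k + l))"
  by (simp add: lpk_gram_def)

lemma lpk_gram_product:
  "transpose_mat (lpk_basis_matrix p m x t) * lpk_weight_matrix K h m x t * lpk_basis_matrix p m x t
     = lpk_gram p K h m x t"
proof (rule eq_matI)
  fix k l assume "k < dim_row (lpk_gram p K h m x t)" "l < dim_col (lpk_gram p K h m x t)"
  then have kl: "k < p + 1" "l < p + 1" by (auto simp: lpk_gram_def)
  have "transpose_mat (lpk_basis_matrix p m x t) * lpk_weight_matrix K h m x t
      = Matrix.mat (p + 1) m (\<lambda>(k, j). (x j - t) ^ k * (K ((x j - t) / h) / h))"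
    unfolding lpk_weight_matrix_def by (subst mat_diag_mult_right[where nr = "p + 1"])
       (auto simp: lpk_basis_matrix_def intro!: eq_matI)
  then show "(transpose_mat (lpk_basis_matrix p m x t) * lpk_weight_matrix K h m x t * lpk_basis_matrix p m x t) $$ (k, l)
      = lpk_gram p K h m x t $$ (k, l)"
    using kl by (auto simp: lpk_basis_matrix_def scalar_prod_def lpk_gram_def power_add mult_ac
         atLeast0LessThan intro!: sum.cong)
qed (auto simp: lpk_gram_def lpk_basis_matrix_def)

text \<open>
  The first row of the inverse Gram matrix is written with the adjugate. In this form the weights are
  visibly measurable functions of the design, and division by zero makes them vanish for a singular
  Gram matrix, in agreement with the default value of the reconstruction.
\<close>

definition lpk_weight ::
    "nat \<Rightarrow> (real \<Rightarrow> real) \<Rightarrow> real \<Rightarrow> nat \<Rightarrow> (nat \<Rightarrow> real) \<Rightarrow> real \<Rightarrow> nat \<Rightarrow> real" where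
  "lpk_weight p K h m x t j =
     (\<Sum>k\<le>p. adj_mat (lpk_gram p K h m x t) $$ (0, k) / Determinant.det (lpk_gram p K h m x t) * (x j - t) ^ k)
       * (K ((x j - t) / h) / h)"

lemma lpk_eq_weighted_sum: "lpk p K h m x y t = (\<Sum>j<m. lpk_weight p K h m x t j * y j)"
proof -
  define S where "S = lpk_gram p K h m x t"
  define Z where "Z = lpk_basis_matrix p m x t"
  define W where "W = lpk_weight_matrix K h m x t"
  have S: "S \<in> carrier_mat (p + 1) (p + 1)" unfolding S_def by (rule lpk_gram_carrier)
  have Z: "Z \<in> carrier_mat m (p + 1)" by (simp add: Z_def lpk_basis_matrix_def)
  have W: "W \<in> carrier_mat m m" by (simp add: W_def lpk_weight_matrix_def)
  have SZ: "transpose_mat Z * W * Z = S"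
    by (simp add: Z_def W_def S_def lpk_gram_product)
  have ZW: "transpose_mat Z * W = Matrix.mat (p + 1) m (\<lambda>(k, j). (x j - t) ^ k * (K ((x j - t) / h) / h))"
    unfolding W_def lpk_weight_matrix_def using Z by (subst mat_diag_mult_right[where nr = "p + 1"])
       (auto simp: Z_def lpk_basis_matrix_def intro!: eq_matI)
  have lpk: "lpk p K h m x y t = (case mat_inverse S of None \<Rightarrow> 0
         | Some G \<Rightarrow> scalar_prod (unit_vec (p + 1) 0) ((G * transpose_mat Z * W) *\<^sub>v Matrix.vec m y))"
    using SZ unfolding lpk_def Let_def Z_def W_def by simp
  show ?thesis
  proof (cases "Determinant.det S = 0")
    case True
    have "mat_inverse S = None"
    proof (cases "mat_inverse S")
      case (Some G)
      then have "S * G = 1\<^sub>m (p + 1)" "G \<in> carrier_mat (p + 1) (p + 1)"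
        using mat_inverse(2)[OF S] by auto
      then have "Determinant.det S * det G = 1" using det_mult[OF S] by (metis det_one)
      with True show ?thesis by simp
    qed
    with True show ?thesis by (simp add: lpk lpk_weight_def S_def)
  next
    case False
    then obtain G where G: "mat_inverse S = Some G"
      using mat_inverse(1)[OF S, of "()"] det_non_zero_imp_unit[OF S False, of "()"] by fastforce
    then have SG: "S * G = 1\<^sub>m (p + 1)" and Gc: "G \<in> carrier_mat (p + 1) (p + 1)"
      using mat_inverse(2)[OF S] by auto
    have adj: "adj_mat S \<in> carrier_mat (p + 1) (p + 1)" "adj_mat S * S = Determinant.det S \<cdot>\<^sub>m 1\<^sub>m (p + 1)"
      using adj_mat[OF S] by auto
    have "adj_mat S = adj_mat S * (S * G)" using adj by (simp add: SG)
    also have "\<dots> = (Determinant.det S \<cdot>\<^sub>m 1\<^sub>m (p + 1)) * G" using adj S Gc by (simp add: assoc_mult_mat[symmetric])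
    also have "\<dots> = Determinant.det S \<cdot>\<^sub>m G" using mult_smult_assoc_mat[OF one_carrier_mat Gc] Gc by simp
    finally have adjG: "adj_mat S = Determinant.det S \<cdot>\<^sub>m G" .
    have G0: "G $$ (0, k) = adj_mat S $$ (0, k) / Determinant.det S" if "k \<le> p" for k
      using that Gc False by (simp add: adjG)
    have GZWc: "G * (transpose_mat Z * W) \<in> carrier_mat (p + 1) m"
      using Z W by (intro mult_carrier_mat[OF Gc] mult_carrier_mat[of _ _ m]) auto
    have GZW: "(G * transpose_mat Z * W) = G * (transpose_mat Z * W)"
      using Gc Z W by (simp add: assoc_mult_mat[of _ "p+1" "p+1" _ m _ m])
    have "lpk p K h m x y t = ((G * (transpose_mat Z * W)) *\<^sub>v Matrix.vec m y) $ 0"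
      unfolding lpk G option.case GZW
      by (rule scalar_prod_left_unit[OF mult_mat_vec_carrier[OF GZWc]]) auto
    also have "\<dots> = (\<Sum>j<m. (G * (transpose_mat Z * W)) $$ (0, j) * y j)"
      using Gc W Z by (simp add: scalar_prod_def atLeast0LessThan)
    also have "\<dots> = (\<Sum>j<m. lpk_weight p K h m x t j * y j)"
    proof (rule sum.cong)
      fix j assume "j \<in> {..<m}"
      then have "(G * (transpose_mat Z * W)) $$ (0, j)
          = (\<Sum>k\<in>{0..<p+1}. G $$ (0, k) * ((x j - t) ^ k * (K ((x j - t) / h) / h)))"
        using Gc W Z unfolding ZW by (auto simp add: scalar_prod_def)
      also have "\<dots> = (\<Sum>k\<le>p. adj_mat S $$ (0, k) / Determinant.det S * ((x j - t) ^ k * (K ((x j - t) / h) / h)))"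
        by (intro sum.cong) (auto simp: G0)
      also have "\<dots> = lpk_weight p K h m x t j"
        unfolding lpk_weight_def S_def sum_distrib_right by (intro sum.cong refl) (simp only: mult_ac)
      finally show "(G * (transpose_mat Z * W)) $$ (0, j) * y j = lpk_weight p K h m x t j * y j" by simp
    qed simp
    finally show ?thesis .
  qed
qed

lemma adj_gram_row:
  assumes "Determinant.det (lpk_gram p K h m x t) \<noteq> 0" "l \<le> p"
  shows "(\<Sum>k\<le>p. adj_mat (lpk_gram p K h m x t) $$ (0, k) / Determinant.det (lpk_gram p K h m x t)
           * lpk_gram p K h m x t $$ (k, l)) = (if l = 0 then 1 else 0)"
proof -
  let ?S = "lpk_gram p K h m x t"
  have S: "?S \<in> carrier_mat (p + 1) (p + 1)" by (rule lpk_gram_carrier)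
  have "(adj_mat ?S * ?S) $$ (0, l) = (\<Sum>k\<in>{0..<p+1}. adj_mat ?S $$ (0, k) * ?S $$ (k, l))"
    using adj_mat(1)[OF S] S \<open>l \<le> p\<close> by (simp add: scalar_prod_def del: lpk_gram_index)
  also have "{0..<p+1} = {..p}" by auto
  finally have "(\<Sum>k\<le>p. adj_mat ?S $$ (0, k) * ?S $$ (k, l)) = (if l = 0 then Determinant.det ?S else 0)"
    using adj_mat(3)[OF S] \<open>l \<le> p\<close> by auto
  then have "(\<Sum>k\<le>p. adj_mat ?S $$ (0, k) * ?S $$ (k, l)) / Determinant.det ?S = (if l = 0 then 1 else 0)"
    using assms by auto
  then show ?thesis by (simp add: sum_divide_distrib del: lpk_gram_index)
qed

text \<open>
  The discrete moments of the weights are the first row of the inverse Gram matrix times the Gram matrix,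
  that is, the first unit vector. Therefore the smoother replaces a polynomial of degree at most \<open>p\<close> in
  \<open>x - t\<close> by its value at \<open>t\<close>.
\<close>

lemma lpk_weights_reproduce_polynomials:
  assumes "Determinant.det (lpk_gram p K h m x t) \<noteq> 0" "l \<le> p"
  shows "(\<Sum>j<m. lpk_weight p K h m x t j * (x j - t) ^ l) = (if l = 0 then 1 else 0)"
proof -
  let ?S = "lpk_gram p K h m x t"
  define \<beta> where "\<beta> k = adj_mat ?S $$ (0, k) / Determinant.det ?S" for k
  have "(\<Sum>j<m. lpk_weight p K h m x t j * (x j - t) ^ l)
      = (\<Sum>j<m. \<Sum>k\<le>p. \<beta> k * (K ((x j - t) / h) / h * (x j - t) ^ (k + l)))"
    unfolding lpk_weight_def \<beta>_def by (simp add: sum_distrib_left sum_distrib_right power_add mult_ac)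
  also have "\<dots> = (\<Sum>k\<le>p. \<beta> k * ?S $$ (k, l))"
    by (subst sum.swap) (use assms in \<open>simp add: sum_distrib_left\<close>)
  finally show ?thesis using adj_gram_row[OF assms] by (simp add: \<beta>_def)
qed

text \<open>
  Rescaled by powers of the bandwidth, the Gram matrix becomes the Hankel matrix of these moments. They are
  averages that converge as the sample grows, so bounds on them are uniform in the bandwidth.
\<close>

definition local_moment :: "(real \<Rightarrow> real) \<Rightarrow> real \<Rightarrow> nat \<Rightarrow> (nat \<Rightarrow> real) \<Rightarrow> real \<Rightarrow> nat \<Rightarrow> real" where
  "local_moment K h m x t s = (\<Sum>j<m. K ((x j - t) / h) / h * ((x j - t) / h) ^ s) / m"

lemma gram_local_moment:
  assumes "0 < h" "0 < m" "k \<le> p" "l \<le> p"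
  shows "lpk_gram p K h m x t $$ (k, l) = m * h ^ (k + l) * local_moment K h m x t (k + l)"
proof -
  have "lpk_gram p K h m x t $$ (k, l)
      = (\<Sum>j<m. h ^ (k + l) * (K ((x j - t) / h) / h * ((x j - t) / h) ^ (k + l)))"
    using assms by (auto simp: power_divide intro!: sum.cong)
  then show ?thesis using assms by (simp only: sum_distrib_left[symmetric]) (simp add: local_moment_def)
qed

text \<open>
  A coercive Hankel form rules out a null vector of the Gram matrix. For the weights, let \<open>g\<close> be the
  rescaled first row of the inverse Gram matrix. The form at \<open>g\<close> equals \<open>g 0\<close>, so coercivity gives
  \<open>\<kappa> \<bar>g\<bar>\<^sup>2 \<le> g 0 \<le> \<bar>g\<bar>\<close> and hence \<open>\<bar>g\<bar> \<le> 1 / \<kappa>\<close>.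
\<close>

lemma lpk_coercive_gram:
  assumes h: "0 < h" and m: "0 < m" and \<kappa>: "0 < \<kappa>"
    and coer: "\<And>q. \<kappa> * (\<Sum>k\<le>p. (q k)\<^sup>2)
                 \<le> (\<Sum>k\<le>p. \<Sum>l\<le>p. q k * q l * local_moment K h m x t (k + l))"
  shows "Determinant.det (lpk_gram p K h m x t) \<noteq> 0"
    and "\<bar>x j - t\<bar> \<le> h \<Longrightarrow>
           \<bar>lpk_weight p K h m x t j\<bar> \<le> real (p + 1) * \<bar>K ((x j - t) / h)\<bar> / (\<kappa> * real m * h)"
proof -
  let ?S = "lpk_gram p K h m x t"
  let ?A = "local_moment K h m x t"
  have S: "?S \<in> carrier_mat (p + 1) (p + 1)" by (rule lpk_gram_carrier)
  show nz: "Determinant.det ?S \<noteq> 0"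
  proof
    assume "Determinant.det ?S = 0"
    then obtain v where v: "v \<in> carrier_vec (p + 1)" "v \<noteq> 0\<^sub>v (p + 1)" "?S *\<^sub>v v = 0\<^sub>v (p + 1)"
      using det_0_iff_vec_prod_zero[OF S] by auto
    have row: "(\<Sum>l\<le>p. ?S $$ (k, l) * v $ l) = 0" if "k \<le> p" for k
    proof -
      have "(?S *\<^sub>v v) $ k = (\<Sum>l\<in>{0..<p+1}. ?S $$ (k, l) * v $ l)"
        using that v(1) S by (simp add: scalar_prod_def del: lpk_gram_index)
      also have "{0..<p+1} = {..p}" by auto
      finally show ?thesis using v that by simp
    qed
    define q where "q k = v $ k * h ^ k" for k
    have "m * (\<Sum>k\<le>p. \<Sum>l\<le>p. q k * q l * ?A (k + l)) = (\<Sum>k\<le>p. v $ k * (\<Sum>l\<le>p. ?S $$ (k, l) * v $ l))"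
      unfolding sum_distrib_left
      by (intro sum.cong refl) (use h m in \<open>simp add: gram_local_moment q_def power_add mult_ac del: lpk_gram_index\<close>)
    also have "\<dots> = 0" by (simp add: row del: lpk_gram_index)
    finally have "(\<Sum>k\<le>p. \<Sum>l\<le>p. q k * q l * ?A (k + l)) = 0" using m by simp
    with coer[of q] \<kappa> have "(\<Sum>k\<le>p. (q k)\<^sup>2) \<le> 0" by (simp add: mult_le_0_iff)
    moreover have "(q k)\<^sup>2 \<le> (\<Sum>k\<le>p. (q k)\<^sup>2)" if "k \<le> p" for k
      by (rule member_le_sum) (use that in auto)
    ultimately have "(q k)\<^sup>2 \<le> 0" if "k \<le> p" for k using that order_trans by blast
    then have "v $ k = 0" if "k \<le> p" for k using that h by (simp add: q_def)
    then have "v = 0\<^sub>v (p + 1)" using v(1) by (intro eq_vecI) auto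
    with v show False by simp
  qed
  define \<beta> where "\<beta> k = adj_mat ?S $$ (0, k) / Determinant.det ?S" for k
  define g where "g k = m * h ^ k * \<beta> k" for k
  have "(\<Sum>k\<le>p. \<Sum>l\<le>p. g k * g l * ?A (k + l)) = (\<Sum>l\<le>p. g l / h ^ l * (\<Sum>k\<le>p. \<beta> k * ?S $$ (k, l)))"
    unfolding sum_distrib_left
    by (subst sum.swap, intro sum.cong refl)
       (use h m in \<open>simp add: gram_local_moment g_def power_add field_simps del: lpk_gram_index\<close>)
  also have "\<dots> = (\<Sum>l\<le>p. if l = 0 then g l else 0)"
    by (rule sum.cong) (use adj_gram_row[OF nz] in \<open>auto simp: \<beta>_def simp del: lpk_gram_index\<close>)
  also have "\<dots> = g 0" by simp
  finally have g0: "\<kappa> * (\<Sum>k\<le>p. (g k)\<^sup>2) \<le> g 0" using coer[of g] by simp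
  have le: "(g k)\<^sup>2 \<le> (\<Sum>k\<le>p. (g k)\<^sup>2)" if "k \<le> p" for k
    by (rule member_le_sum) (use that in auto)
  have "\<kappa> * (g 0)\<^sup>2 \<le> g 0" using g0 le[of 0] \<kappa> by (meson le0 mult_left_mono less_imp_le order_trans)
  then have "\<kappa> * g 0 \<le> 1" using \<kappa> 
    by (cases "g 0 > 0") (simp_all add: power2_eq_square mult_le_0_iff order_trans[of _ 0 1])
  then have "\<kappa> * (\<kappa> * (\<Sum>k\<le>p. (g k)\<^sup>2)) \<le> 1" using g0 \<kappa> by (meson mult_left_mono less_imp_le order_trans)
  then have sq: "(\<kappa> * g k)\<^sup>2 \<le> 1" if "k \<le> p" for k
    using \<kappa> order_trans[OF mult_left_mono[OF mult_left_mono[OF le[OF that], of \<kappa>], of \<kappa>]]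
    by (simp add: power_mult_distrib power2_eq_square[of \<kappa>] mult.assoc)
  have gk: "\<bar>g k\<bar> \<le> 1 / \<kappa>" if "k \<le> p" for k
  proof -
    have "\<bar>\<kappa> * g k\<bar> \<le> 1" using sq[OF that] by (simp only: abs_square_le_1)
    then show ?thesis using \<kappa> by (simp add: abs_mult field_simps)
  qed
  assume xj: "\<bar>x j - t\<bar> \<le> h"
  let ?u = "(x j - t) / h"
  have "(\<Sum>k\<le>p. \<beta> k * (x j - t) ^ k) = (\<Sum>k\<le>p. g k * ?u ^ k) / m"
    unfolding sum_divide_distrib
    by (intro sum.cong refl) (use h m in \<open>simp add: g_def power_divide field_simps\<close>)
  moreover have "\<bar>\<Sum>k\<le>p. g k * ?u ^ k\<bar> \<le> (\<Sum>k\<le>p. 1 / \<kappa>)"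
  proof (intro order_trans[OF sum_abs] sum_mono)
    fix k assume "k \<in> {..p}"
    then have "\<bar>g k\<bar> \<le> 1 / \<kappa>" using gk by auto
    moreover have "\<bar>?u ^ k\<bar> \<le> 1" using xj h by (auto simp: power_abs intro!: power_le_one)
    ultimately have "\<bar>g k\<bar> * \<bar>?u ^ k\<bar> \<le> 1 / \<kappa> * 1" using \<kappa> by (intro mult_mono) auto
    then show "\<bar>g k * ?u ^ k\<bar> \<le> 1 / \<kappa>" by (simp add: abs_mult)
  qed
  ultimately have "\<bar>\<Sum>k\<le>p. \<beta> k * (x j - t) ^ k\<bar> \<le> (p + 1) / \<kappa> / m"
    using m divide_right_mono[of "\<bar>\<Sum>k\<le>p. g k * ?u ^ k\<bar>" "(p + 1) / \<kappa>" m] by simp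
  then have "\<bar>\<Sum>k\<le>p. \<beta> k * (x j - t) ^ k\<bar> * \<bar>K ?u / h\<bar> \<le> (p + 1) / \<kappa> / m * \<bar>K ?u / h\<bar>"
    by (intro mult_right_mono) auto
  then show "\<bar>lpk_weight p K h m x t j\<bar> \<le> real (p + 1) * \<bar>K ?u\<bar> / (\<kappa> * real m * h)"
    using h unfolding lpk_weight_def \<beta>_def by (simp add: abs_mult)
qed

lemma borel_measurable_det:
  fixes A :: "'a \<Rightarrow> real mat"
  assumes "\<And>\<omega>. A \<omega> \<in> carrier_mat n n"
    and "\<And>i j. i < n \<Longrightarrow> j < n \<Longrightarrow> (\<lambda>\<omega>. A \<omega> $$ (i, j)) \<in> borel_measurable F"
  shows "(\<lambda>\<omega>. Determinant.det (A \<omega>)) \<in> borel_measurable F"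
proof -
  have "(\<lambda>\<omega>. Determinant.det (A \<omega>)) = (\<lambda>\<omega>. \<Sum>p | p permutes {0..<n}. signof p * (\<Prod>i = 0..<n. A \<omega> $$ (i, p i)))"
    using det_def'[OF assms(1)] by auto
  also have "\<dots> \<in> borel_measurable F"
    by (intro borel_measurable_sum borel_measurable_times borel_measurable_const borel_measurable_prod assms(2))
       (auto dest: permutes_in_image)
  finally show ?thesis .
qed

text \<open>
  The \<open>\<sigma>\<close>-algebra is arbitrary because the weights must be measurable with respect to the algebra generated
  by the design: only then can they be pulled out of conditional expectations given the design.
\<close>

lemma borel_measurable_lpk_weight:
  assumes x: "\<And>j. j < m \<Longrightarrow> (\<lambda>\<omega>. x \<omega> j) \<in> borel_measurable F"
    and K[measurable]: "K \<in> borel_measurable borel" and "j < m"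
  shows "(\<lambda>\<omega>. lpk_weight p K h m (x \<omega>) t j) \<in> borel_measurable F"
proof -
  have [measurable]: "(\<lambda>\<omega>. x \<omega> j) \<in> borel_measurable F" using x \<open>j < m\<close> by auto
  have S: "(\<lambda>\<omega>. lpk_gram p K h m (x \<omega>) t $$ (k, l)) \<in> borel_measurable F" if "k < p + 1" "l < p + 1" for k l
  proof -
    have "(\<lambda>\<omega>. K ((x \<omega> j - t) / h) / h * (x \<omega> j - t) ^ (k + l)) \<in> borel_measurable F" if "j < m" for j
    proof -
      have [measurable]: "(\<lambda>\<omega>. x \<omega> j) \<in> borel_measurable F" using x that by auto
      show ?thesis by measurable
    qed
    then show ?thesis using that by (auto simp: less_Suc_eq_le)
  qed
  have [measurable]: "(\<lambda>\<omega>. Determinant.det (lpk_gram p K h m (x \<omega>) t)) \<in> borel_measurable F"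
    by (rule borel_measurable_det[OF lpk_gram_carrier]) (rule S)
  have "(\<lambda>\<omega>. adj_mat (lpk_gram p K h m (x \<omega>) t) $$ (0, k)) \<in> borel_measurable F" if "k \<le> p" for k
  proof -
    have "adj_mat (lpk_gram p K h m (x \<omega>) t) $$ (0, k)
        = (-1) ^ k * Determinant.det (mat_delete (lpk_gram p K h m (x \<omega>) t) k 0)" for \<omega>
      using that lpk_gram_carrier[of p K h m "x \<omega>" t]
      by (auto simp: adj_mat_def cofactor_def)
    moreover have "(\<lambda>\<omega>. Determinant.det (mat_delete (lpk_gram p K h m (x \<omega>) t) k 0)) \<in> borel_measurable F"
    proof (rule borel_measurable_det[of _ p])
      show "mat_delete (lpk_gram p K h m (x \<omega>) t) k 0 \<in> carrier_mat p p" for \<omega>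
        by (auto simp: mat_delete_def lpk_gram_def)
      fix i j assume ij: "i < p" "j < p"
      have dims: "dim_row (lpk_gram p K h m (x \<omega>) t) = p + 1" "dim_col (lpk_gram p K h m (x \<omega>) t) = p + 1" for \<omega>
        using lpk_gram_carrier by blast+
      from ij have "(\<lambda>\<omega>. mat_delete (lpk_gram p K h m (x \<omega>) t) k 0 $$ (i, j))
          = (\<lambda>\<omega>. lpk_gram p K h m (x \<omega>) t $$ (if i < k then i else Suc i, Suc j))"
        by (auto simp: mat_delete_def dims simp del: lpk_gram_index)
      also have "\<dots> \<in> borel_measurable F" using ij by (intro S) auto
      finally show "(\<lambda>\<omega>. mat_delete (lpk_gram p K h m (x \<omega>) t) k 0 $$ (i, j)) \<in> borel_measurable F" .
    qed
    ultimately show ?thesis by simp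
  qed
  then show ?thesis unfolding lpk_weight_def
    by (intro borel_measurable_times borel_measurable_sum borel_measurable_divide) auto
qed

section \<open>Moments of a random design\<close>

text \<open>
  Moments off by at most \<open>\<kappa> / (p + 1)\<close> change the form by at most \<open>\<kappa> / (p + 1) * (\<Sum>k\<le>p. \<bar>q k\<bar>)\<^sup>2\<close>, which is
  bounded by \<open>\<kappa> * (\<Sum>k\<le>p. (q k)\<^sup>2)\<close>; half of the coercivity constant survives.
\<close>

lemma coercive_if_moments_close:
  fixes A \<mu> :: "nat \<Rightarrow> real"
  assumes \<mu>: "\<And>q. 2 * \<kappa> * (\<Sum>k\<le>p. (q k)\<^sup>2) \<le> (\<Sum>k\<le>p. \<Sum>l\<le>p. q k * q l * \<mu> (k + l))"
    and close: "\<And>s. s \<le> 2 * p \<Longrightarrow> \<bar>A s - \<mu> s\<bar> \<le> \<kappa> / (p + 1)"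
  shows "\<kappa> * (\<Sum>k\<le>p. (q k)\<^sup>2) \<le> (\<Sum>k\<le>p. \<Sum>l\<le>p. q k * q l * A (k + l))"
proof -
  have \<kappa>: "0 \<le> \<kappa> / (p + 1)" using close[of 0] by linarith
  have "(\<Sum>k\<le>p. \<Sum>l\<le>p. q k * q l * \<mu> (k + l)) - (\<Sum>k\<le>p. \<Sum>l\<le>p. q k * q l * A (k + l))
      = (\<Sum>k\<le>p. \<Sum>l\<le>p. q k * q l * (\<mu> (k + l) - A (k + l)))"
    by (simp add: sum_subtractf algebra_simps)
  also have "\<dots> \<le> (\<Sum>k\<le>p. \<Sum>l\<le>p. ((q k)\<^sup>2 + (q l)\<^sup>2) / 2 * (\<kappa> / (p + 1)))"
  proof (intro sum_mono)
    fix k l assume kl: "k \<in> {..p}" "l \<in> {..p}"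
    have "\<bar>\<mu> (k + l) - A (k + l)\<bar> \<le> \<kappa> / (p + 1)" using close[of "k + l"] kl by (auto simp: abs_minus_commute)
    moreover have "\<bar>q k * q l\<bar> \<le> ((q k)\<^sup>2 + (q l)\<^sup>2) / 2"
      using zero_le_power2[of "\<bar>q k\<bar> - \<bar>q l\<bar>"] by (simp add: power2_diff abs_mult)
    ultimately have "\<bar>q k * q l\<bar> * \<bar>\<mu> (k + l) - A (k + l)\<bar> \<le> ((q k)\<^sup>2 + (q l)\<^sup>2) / 2 * (\<kappa> / (p + 1))"
      by (intro mult_mono) auto
    then show "q k * q l * (\<mu> (k + l) - A (k + l)) \<le> ((q k)\<^sup>2 + (q l)\<^sup>2) / 2 * (\<kappa> / (p + 1))"
      using abs_ge_self[of "q k * q l * (\<mu> (k + l) - A (k + l))"] unfolding abs_mult by linarith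
  qed
  also have "\<dots> = (\<Sum>k\<le>p. \<Sum>l\<le>p. (q k)\<^sup>2 + (q l)\<^sup>2) / 2 * (\<kappa> / (p + 1))"
    by (simp add: sum_distrib_right sum_divide_distrib)
  also have "(\<Sum>k\<le>p. \<Sum>l\<le>p. (q k)\<^sup>2 + (q l)\<^sup>2) = 2 * (p + 1) * (\<Sum>k\<le>p. (q k)\<^sup>2)"
    by (simp add: sum.distrib sum_distrib_left[symmetric] algebra_simps)
  also have "2 * (p + 1) * (\<Sum>k\<le>p. (q k)\<^sup>2) / 2 * (\<kappa> / (p + 1)) = \<kappa> * (\<Sum>k\<le>p. (q k)\<^sup>2)"
    by (simp add: field_simps)
  finally show ?thesis using \<mu>[of q] by simp
qed

text \<open>
  This inequality of Chebyshev type serves two kinds of sums: the centered kernel terms of an independent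
  design, and the weighted errors, which are merely uncorrelated given the design.
\<close>

lemma (in prob_space) orthogonal_sum_tail:
  fixes Y :: "'i \<Rightarrow> 'a \<Rightarrow> real"
  assumes I: "finite I"
    and Y[measurable]: "\<And>j. j \<in> I \<Longrightarrow> Y j \<in> borel_measurable M"
    and sq: "\<And>j. j \<in> I \<Longrightarrow> integrable M (\<lambda>\<omega>. (Y j \<omega>)\<^sup>2)"
    and orth: "\<And>j k. j \<in> I \<Longrightarrow> k \<in> I \<Longrightarrow> j \<noteq> k \<Longrightarrow> expectation (\<lambda>\<omega>. Y j \<omega> * Y k \<omega>) = 0"
    and B: "0 < B"
  shows "prob {\<omega> \<in> space M. \<bar>\<Sum>j\<in>I. Y j \<omega>\<bar> \<ge> B} \<le> (\<Sum>j\<in>I. expectation (\<lambda>\<omega>. (Y j \<omega>)\<^sup>2)) / B\<^sup>2"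
proof -
  have int: "integrable M (\<lambda>\<omega>. Y j \<omega> * Y k \<omega>)" if jk: "j \<in> I" "k \<in> I" for j k
  proof (rule Bochner_Integration.integrable_bound)
    show "integrable M (\<lambda>\<omega>. (Y j \<omega>)\<^sup>2 + (Y k \<omega>)\<^sup>2)" using sq jk by simp
    show "AE \<omega> in M. norm (Y j \<omega> * Y k \<omega>) \<le> norm ((Y j \<omega>)\<^sup>2 + (Y k \<omega>)\<^sup>2)"
    proof (rule AE_I2)
      fix \<omega>
      have "2 * (\<bar>Y j \<omega>\<bar> * \<bar>Y k \<omega>\<bar>) \<le> (Y j \<omega>)\<^sup>2 + (Y k \<omega>)\<^sup>2"
        using zero_le_power2[of "\<bar>Y j \<omega>\<bar> - \<bar>Y k \<omega>\<bar>"] by (simp add: power2_diff)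
      moreover have "0 \<le> \<bar>Y j \<omega>\<bar> * \<bar>Y k \<omega>\<bar>" by simp
      ultimately show "norm (Y j \<omega> * Y k \<omega>) \<le> norm ((Y j \<omega>)\<^sup>2 + (Y k \<omega>)\<^sup>2)"
        unfolding real_norm_def abs_mult by linarith
    qed
  qed (use jk in measurable)
  have expand: "(\<Sum>j\<in>I. Y j \<omega>)\<^sup>2 = (\<Sum>j\<in>I. \<Sum>k\<in>I. Y j \<omega> * Y k \<omega>)" for \<omega>
    by (simp add: power2_eq_square sum_product)
  have int2: "integrable M (\<lambda>\<omega>. (\<Sum>j\<in>I. Y j \<omega>)\<^sup>2)"
    unfolding expand by (intro Bochner_Integration.integrable_sum int)
  have "prob {\<omega> \<in> space M. \<bar>\<Sum>j\<in>I. Y j \<omega>\<bar> \<ge> B} \<le> expectation (\<lambda>\<omega>. (\<Sum>j\<in>I. Y j \<omega>)\<^sup>2) / B\<^sup>2"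
    by (rule second_moment_method) (use B int2 in \<open>auto intro!: borel_measurable_sum\<close>)
  also have "expectation (\<lambda>\<omega>. (\<Sum>j\<in>I. Y j \<omega>)\<^sup>2) = (\<Sum>j\<in>I. \<Sum>k\<in>I. expectation (\<lambda>\<omega>. Y j \<omega> * Y k \<omega>))"
    unfolding expand by (simp add: int Bochner_Integration.integral_sum Bochner_Integration.integrable_sum)
  also have "\<dots> = (\<Sum>j\<in>I. \<Sum>k\<in>I. if k = j then expectation (\<lambda>\<omega>. (Y j \<omega>)\<^sup>2) else 0)"
    by (intro sum.cong refl) (auto simp: orth power2_eq_square)
  also have "\<dots> = (\<Sum>j\<in>I. expectation (\<lambda>\<omega>. (Y j \<omega>)\<^sup>2))"
    by (intro sum.cong refl) (use I in \<open>simp add: sum.delta\<close>)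
  finally show ?thesis .
qed

lemma (in prob_space) indep_vars_imp_indep_var:
  assumes "indep_vars M' Y I" "i \<in> I" "k \<in> I" "i \<noteq> k"
  shows "indep_var (M' i) (Y i) (M' k) (Y k)"
proof -
  have "indep_var (PiM {i} M') (\<lambda>\<omega>. restrict (\<lambda>i. Y i \<omega>) {i}) (PiM {k} M') (\<lambda>\<omega>. restrict (\<lambda>i. Y i \<omega>) {k})"
    by (rule indep_var_restrict[OF assms(1)]) (use assms in auto)
  from indep_var_compose[OF this, of "\<lambda>x. x i" "M' i" "\<lambda>x. x k" "M' k"]
  show ?thesis by (simp add: comp_def)
qed

text \<open>
  The situation of one individual at one time point \<open>t\<close>: independent design points \<open>X j\<close> and a window
  of half-width \<open>h\<close> around \<open>t\<close>. The density need only be bounded on the window, where it may also vanish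
  in part; this covers windows that stick out of the design interval.
\<close>

locale windowed_sample = prob_space M for M :: "'w measure" +
  fixes m :: nat and X :: "nat \<Rightarrow> 'w \<Rightarrow> real" and \<pi> K :: "real \<Rightarrow> real" and B \<pi>1 t h :: real
  assumes m_pos: "0 < m" and h_pos: "0 < h"
    and X_distr: "\<And>j. j < m \<Longrightarrow> distributed M lborel (X j) (\<lambda>x. ennreal (\<pi> x))"
    and X_indep: "\<And>j k. j < m \<Longrightarrow> k < m \<Longrightarrow> j \<noteq> k \<Longrightarrow> indep_var borel (X j) borel (X k)"
    and pi_measurable [measurable]: "\<pi> \<in> borel_measurable borel"
    and pi_nonneg: "\<And>x. 0 \<le> \<pi> x"
    and pi_le: "\<And>x. \<bar>x - t\<bar> \<le> h \<Longrightarrow> \<pi> x \<le> \<pi>1"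
    and K_measurable [measurable]: "K \<in> borel_measurable borel"
    and K_nonneg: "\<And>u. 0 \<le> K u"
    and K_le: "\<And>u. K u \<le> B"
    and K_outside: "\<And>u. u \<notin> {-1..1} \<Longrightarrow> K u = 0"
begin

lemma X_measurable: "j < m \<Longrightarrow> X j \<in> borel_measurable M"
  using distributed_measurable[OF X_distr] by simp

lemma B_nonneg: "0 \<le> B"
  using K_nonneg[of 0] K_le[of 0] by linarith

lemma pi1_nonneg: "0 \<le> \<pi>1"
  using pi_nonneg[of t] pi_le[of t] h_pos by simp

lemma prob_window:
  assumes j: "j < m"
  shows "prob {\<omega> \<in> space M. \<bar>X j \<omega> - t\<bar> \<le> h} \<le> 2 * h * \<pi>1"
proof -
  have "emeasure M {\<omega> \<in> space M. \<bar>X j \<omega> - t\<bar> \<le> h} = emeasure M (X j -` {t - h..t + h} \<inter> space M)"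
    by (rule arg_cong[where f = "emeasure M"]) (auto simp: abs_le_iff)
  also have "\<dots> = (\<integral>\<^sup>+x. ennreal (\<pi> x) * indicator {t - h..t + h} x \<partial>lborel)"
    by (rule distributed_emeasure[OF X_distr[OF j]]) simp
  also have "\<dots> \<le> (\<integral>\<^sup>+x. ennreal \<pi>1 * indicator {t - h..t + h} x \<partial>lborel)"
    by (intro nn_integral_mono) (auto simp: indicator_def abs_le_iff intro!: ennreal_leI pi_le)
  also have "\<dots> = ennreal (2 * h * \<pi>1)"
    using h_pos pi1_nonneg by (simp add: nn_integral_cmult ennreal_mult' mult.commute ennreal_mult'')
  finally show ?thesis
    using h_pos pi1_nonneg by (simp add: emeasure_eq_measure)
qed

definition kernel_power :: "nat \<Rightarrow> real \<Rightarrow> real" where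
  "kernel_power s x = K ((x - t) / h) / h * ((x - t) / h) ^ s"

definition kernel_mean :: "nat \<Rightarrow> real" where
  "kernel_mean s = (\<integral>x. \<pi> x * kernel_power s x \<partial>lborel)"

lemma kernel_power_measurable [measurable]: "kernel_power s \<in> borel_measurable borel"
  unfolding kernel_power_def[abs_def] by measurable

lemma kernel_power_le: "\<bar>kernel_power s x\<bar> \<le> B / h * indicator {t - h..t + h} x"
proof (cases "\<bar>x - t\<bar> \<le> h")
  case True
  then have "\<bar>(x - t) / h\<bar> ^ s \<le> 1" using h_pos by (intro power_le_one) auto
  moreover have "\<bar>K ((x - t) / h) / h\<bar> \<le> B / h"
    using h_pos K_nonneg K_le by (simp add: divide_right_mono)
  ultimately have "\<bar>K ((x - t) / h) / h\<bar> * \<bar>(x - t) / h\<bar> ^ s \<le> B / h * 1"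
    using B_nonneg h_pos by (intro mult_mono) auto
  then show ?thesis using True by (simp add: kernel_power_def abs_mult power_abs indicator_def abs_le_iff)
next
  case False
  then have "(x - t) / h \<notin> {-1..1}" using h_pos by (auto simp: field_simps)
  then have "K ((x - t) / h) = 0" by (rule K_outside)
  then show ?thesis using B_nonneg h_pos by (simp add: kernel_power_def)
qed

lemma integrable_kernel_power:
  assumes j: "j < m"
  shows "integrable M (\<lambda>\<omega>. kernel_power s (X j \<omega>))"
    and "integrable M (\<lambda>\<omega>. (kernel_power s (X j \<omega>))\<^sup>2)"
    and "expectation (\<lambda>\<omega>. kernel_power s (X j \<omega>)) = kernel_mean s"
    and "expectation (\<lambda>\<omega>. (kernel_power s (X j \<omega>))\<^sup>2) \<le> 2 * B\<^sup>2 * \<pi>1 / h"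
proof -
  note [measurable] = X_measurable[OF j]
  have bd: "\<bar>kernel_power s x\<bar> \<le> B / h" for x
    using kernel_power_le[of s x] B_nonneg h_pos by (auto simp: indicator_def split: if_splits intro: order_trans)
  show "integrable M (\<lambda>\<omega>. kernel_power s (X j \<omega>))"
    by (rule integrable_const_bound[where B = "B / h"]) (use bd in auto)
  show int2: "integrable M (\<lambda>\<omega>. (kernel_power s (X j \<omega>))\<^sup>2)"
  proof (rule integrable_const_bound[where B = "(B / h)\<^sup>2"])
    show "AE \<omega> in M. norm ((kernel_power s (X j \<omega>))\<^sup>2) \<le> (B / h)\<^sup>2"
    proof (rule AE_I2)
      fix \<omega> show "norm ((kernel_power s (X j \<omega>))\<^sup>2) \<le> (B / h)\<^sup>2"
        using power_mono[OF bd[of "X j \<omega>"], of 2] by simp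
    qed
  qed measurable
  show "expectation (\<lambda>\<omega>. kernel_power s (X j \<omega>)) = kernel_mean s"
    unfolding kernel_mean_def by (rule distributed_integral[OF X_distr[OF j], symmetric]) (auto simp: pi_nonneg)
  have "expectation (\<lambda>\<omega>. (kernel_power s (X j \<omega>))\<^sup>2)
      \<le> expectation (\<lambda>\<omega>. (B / h)\<^sup>2 * indicator {\<omega> \<in> space M. \<bar>X j \<omega> - t\<bar> \<le> h} \<omega>)"
  proof (rule integral_mono[OF int2])
    fix \<omega> assume "\<omega> \<in> space M"
    then show "(kernel_power s (X j \<omega>))\<^sup>2 \<le> (B / h)\<^sup>2 * indicator {\<omega> \<in> space M. \<bar>X j \<omega> - t\<bar> \<le> h} \<omega>"
      using power_mono[OF kernel_power_le[of s "X j \<omega>"], of 2]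
      by (auto simp: indicator_def abs_le_iff split: if_splits)
  qed (auto intro!: integrable_real_mult_indicator simp: mult.commute less_top[symmetric])
  also have "\<dots> = (B / h)\<^sup>2 * prob {\<omega> \<in> space M. \<bar>X j \<omega> - t\<bar> \<le> h}"
    by simp
  also have "\<dots> \<le> (B / h)\<^sup>2 * (2 * h * \<pi>1)"
    by (intro mult_left_mono prob_window j) auto
  also have "\<dots> = 2 * B\<^sup>2 * \<pi>1 / h" using h_pos by (simp add: power2_eq_square field_simps)
  finally show "expectation (\<lambda>\<omega>. (kernel_power s (X j \<omega>))\<^sup>2) \<le> 2 * B\<^sup>2 * \<pi>1 / h" .
qed

lemma local_moment_kernel_power:
  "local_moment K h m x t s = (\<Sum>j<m. kernel_power s (x j)) / m"
  by (simp add: local_moment_def kernel_power_def)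

text \<open>
  A kernel term is of size \<open>O(1 / h)\<close> on an event of probability \<open>O(h)\<close>, so its variance is \<open>O(1 / h)\<close> and that
  of the average of \<open>m\<close> terms is \<open>O(1 / (m * h))\<close>.
\<close>

lemma local_moment_concentration:
  assumes e: "0 < e"
  shows "prob {\<omega> \<in> space M. \<bar>local_moment K h m (\<lambda>j. X j \<omega>) t s - kernel_mean s\<bar> \<ge> e}
           \<le> 2 * B\<^sup>2 * \<pi>1 / (m * h * e\<^sup>2)"
proof -
  define Y where "Y j \<omega> = kernel_power s (X j \<omega>) - kernel_mean s" for j \<omega>
  have Ym: "Y j \<in> borel_measurable M" if "j < m" for j
    unfolding Y_def[abs_def] using X_measurable[OF that] by measurable
  have sq: "integrable M (\<lambda>\<omega>. (Y j \<omega>)\<^sup>2)" and var: "expectation (\<lambda>\<omega>. (Y j \<omega>)\<^sup>2) \<le> 2 * B\<^sup>2 * \<pi>1 / h"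
    and int: "integrable M (Y j)" and mean: "expectation (Y j) = 0" if j: "j < m" for j
  proof -
    note ik = integrable_kernel_power[OF j, of s]
    show "integrable M (\<lambda>\<omega>. (Y j \<omega>)\<^sup>2)" unfolding Y_def power2_diff using ik by simp
    show "integrable M (Y j)" "expectation (Y j) = 0" unfolding Y_def[abs_def] using ik by (simp_all add: prob_space)
    have "expectation (\<lambda>\<omega>. (Y j \<omega>)\<^sup>2) = variance (\<lambda>\<omega>. kernel_power s (X j \<omega>))"
      unfolding Y_def ik(3) ..
    also have "\<dots> = expectation (\<lambda>\<omega>. (kernel_power s (X j \<omega>))\<^sup>2) - (kernel_mean s)\<^sup>2"
      using variance_eq[OF ik(1,2)] ik(3) by simp
    also have "\<dots> \<le> expectation (\<lambda>\<omega>. (kernel_power s (X j \<omega>))\<^sup>2)" by simp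
    also note ik(4)
    finally show "expectation (\<lambda>\<omega>. (Y j \<omega>)\<^sup>2) \<le> 2 * B\<^sup>2 * \<pi>1 / h" .
  qed
  have orth: "expectation (\<lambda>\<omega>. Y j \<omega> * Y k \<omega>) = 0" if "j < m" "k < m" "j \<noteq> k" for j k
  proof -
    have "indep_var borel (Y j) borel (Y k)"
      using indep_var_compose[OF X_indep[OF that], of "\<lambda>x. kernel_power s x - kernel_mean s" borel
          "\<lambda>x. kernel_power s x - kernel_mean s" borel]
      by (simp add: comp_def Y_def[abs_def])
    from indep_var_lebesgue_integral[OF this] int mean that show ?thesis by simp
  qed
  have mh: "0 < real m * e" using m_pos e by simp
  have "prob {\<omega> \<in> space M. \<bar>local_moment K h m (\<lambda>j. X j \<omega>) t s - kernel_mean s\<bar> \<ge> e}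
      = prob {\<omega> \<in> space M. \<bar>\<Sum>j<m. Y j \<omega>\<bar> \<ge> m * e}"
  proof -
    have "local_moment K h m (\<lambda>j. X j \<omega>) t s - kernel_mean s = (\<Sum>j<m. Y j \<omega>) / m" for \<omega>
      using m_pos by (simp add: local_moment_kernel_power Y_def sum_subtractf diff_divide_distrib)
    then show ?thesis using m_pos by (simp add: abs_divide pos_le_divide_eq mult.commute)
  qed
  also have "\<dots> \<le> (\<Sum>j<m. expectation (\<lambda>\<omega>. (Y j \<omega>)\<^sup>2)) / (m * e)\<^sup>2"
    by (rule orthogonal_sum_tail) (use Ym sq orth mh in auto)
  also have "\<dots> \<le> (\<Sum>j<m. 2 * B\<^sup>2 * \<pi>1 / h) / (m * e)\<^sup>2"
    by (intro divide_right_mono sum_mono var) auto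
  also have "\<dots> = 2 * B\<^sup>2 * \<pi>1 / (m * h * e\<^sup>2)"
    using m_pos by (simp add: power_mult_distrib power2_eq_square mult_ac)
  finally show ?thesis .
qed

text \<open>
  In the coordinate \<open>u = (x - t) / h\<close> the expected form is the integral of
  \<open>\<pi> (t + h * u) * K u * (\<Sum>k\<le>p. q k * u ^ k)\<^sup>2\<close>. Restricting it to a set \<open>I\<close> of coordinates \<open>u\<close> where
  the density is at least \<open>\<pi>0\<close> leaves \<open>\<pi>0\<close> times a form that depends on the kernel only, not on \<open>t\<close> or \<open>h\<close>.
\<close>

lemma kernel_mean_coercive:
  assumes c: "\<And>q. c * (\<Sum>k\<le>p. (q k)\<^sup>2) \<le> (\<integral>u. indicator I u * K u * (\<Sum>k\<le>p. q k * u ^ k)\<^sup>2 \<partial>lborel)"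
    and \<pi>0: "0 \<le> \<pi>0" and I: "I \<in> sets borel" "\<And>u. u \<in> I \<Longrightarrow> \<pi>0 \<le> \<pi> (t + h * u)"
  shows "\<pi>0 * c * (\<Sum>k\<le>p. (q k)\<^sup>2) \<le> (\<Sum>k\<le>p. \<Sum>l\<le>p. q k * q l * kernel_mean (k + l))"
proof -
  note [measurable] = I(1)
  have bd: "integrable lborel g"
    if [measurable]: "g \<in> borel_measurable borel" and g: "\<And>u. \<bar>g u\<bar> \<le> Cb * indicator {-1..1} u" for g :: "real \<Rightarrow> real" and Cb :: real
  proof (rule Bochner_Integration.integrable_bound)
    show "integrable lborel (\<lambda>u. Cb * indicator {-1..1::real} u)" by simp
    show "AE u in lborel. norm (g u) \<le> norm (Cb * indicator {-1..1::real} u)"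
      using order_trans[OF g abs_ge_self] by (intro AE_I2) simp
  qed measurable
  have int: "integrable lborel (\<lambda>u. \<pi> (t + h * u) * K u * u ^ s)" for s
  proof (rule bd[of _ "\<pi>1 * B"])
    fix u :: real
    show "\<bar>\<pi> (t + h * u) * K u * u ^ s\<bar> \<le> \<pi>1 * B * indicator {-1..1} u"
    proof (cases "u \<in> {-1..1}")
      case True
      then have "\<bar>h * u\<bar> \<le> h * 1" unfolding abs_mult using h_pos by (intro mult_mono) auto
      then have "\<pi> (t + h * u) \<le> \<pi>1" by (intro pi_le) auto
      moreover have "\<bar>u ^ s\<bar> \<le> 1" using True unfolding power_abs by (intro power_le_one) auto
      ultimately have "\<bar>\<pi> (t + h * u)\<bar> * \<bar>K u\<bar> * \<bar>u ^ s\<bar> \<le> \<pi>1 * B * 1"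
        using pi_nonneg K_nonneg K_le pi1_nonneg B_nonneg by (intro mult_mono) auto
      then show ?thesis using True by (simp add: abs_mult)
    qed (simp add: K_outside)
  qed measurable
  have mean: "kernel_mean s = (\<integral>u. \<pi> (t + h * u) * K u * u ^ s \<partial>lborel)" for s
  proof -
    have "kernel_mean s = h * (\<integral>u. \<pi> (t + h * u) * kernel_power s (t + h * u) \<partial>lborel)"
      unfolding kernel_mean_def
      by (subst lborel_integral_real_affine[where c = h and t = t]) (use h_pos in auto)
    also have "\<dots> = (\<integral>u. h * (\<pi> (t + h * u) * kernel_power s (t + h * u)) \<partial>lborel)" by simp
    also have "\<dots> = (\<integral>u. \<pi> (t + h * u) * K u * u ^ s \<partial>lborel)"
      by (rule Bochner_Integration.integral_cong) (use h_pos in \<open>simp_all add: kernel_power_def\<close>)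
    finally show ?thesis .
  qed
  have ex: "\<pi> (t + h * u) * K u * (\<Sum>k\<le>p. q k * u ^ k)\<^sup>2
      = (\<Sum>k\<le>p. \<Sum>l\<le>p. q k * q l * (\<pi> (t + h * u) * K u * u ^ (k + l)))" for u
    by (simp add: power2_eq_square sum_product sum_distrib_left power_add algebra_simps)
  have intq: "integrable lborel (\<lambda>u. \<pi> (t + h * u) * K u * (\<Sum>k\<le>p. q k * u ^ k)\<^sup>2)"
    unfolding ex by (intro Bochner_Integration.integrable_sum integrable_mult_right int)
  have "\<pi>0 * c * (\<Sum>k\<le>p. (q k)\<^sup>2) \<le> \<pi>0 * (\<integral>u. indicator I u * K u * (\<Sum>k\<le>p. q k * u ^ k)\<^sup>2 \<partial>lborel)"
    unfolding mult.assoc by (intro mult_left_mono \<pi>0 c[unfolded mult.assoc])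
  also have "\<dots> = (\<integral>u. \<pi>0 * (indicator I u * K u * (\<Sum>k\<le>p. q k * u ^ k)\<^sup>2) \<partial>lborel)" by simp
  also have "\<dots> \<le> (\<integral>u. \<pi> (t + h * u) * K u * (\<Sum>k\<le>p. q k * u ^ k)\<^sup>2 \<partial>lborel)"
  proof (rule integral_mono')
    fix u
    show "\<pi>0 * (indicator I u * K u * (\<Sum>k\<le>p. q k * u ^ k)\<^sup>2) \<le> \<pi> (t + h * u) * K u * (\<Sum>k\<le>p. q k * u ^ k)\<^sup>2"
      unfolding mult.assoc[symmetric]
      using I(2)[of u] K_nonneg[of u] pi_nonneg by (auto simp: indicator_def intro!: mult_right_mono)
    show "0 \<le> \<pi> (t + h * u) * K u * (\<Sum>k\<le>p. q k * u ^ k)\<^sup>2" using K_nonneg pi_nonneg by simp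
  qed (rule intq)
  also have "\<dots> = (\<Sum>k\<le>p. \<Sum>l\<le>p. q k * q l * kernel_mean (k + l))"
    unfolding ex mean
    by (simp add: int Bochner_Integration.integral_sum Bochner_Integration.integrable_sum)
  finally show ?thesis .
qed

end

section \<open>Noise and the finite sample error\<close>

context windowed_sample
begin

text \<open>
  At coinciding design points the error covariance is the variance instead of zero, so ties have to be
  excluded before the errors can be treated as uncorrelated.
\<close>

lemma AE_X_distinct:
  assumes "j < m" "k < m" "j \<noteq> k"
  shows "AE \<omega> in M. X j \<omega> \<noteq> X k \<omega>"
proof -
  have "indep_var lborel (X j) lborel (X k)"
    using X_indep[OF assms] unfolding indep_var_eq by simp
  then have joint: "distributed M (lborel \<Otimes>\<^sub>M lborel) (\<lambda>\<omega>. (X j \<omega>, X k \<omega>))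
      (\<lambda>(x, y). ennreal (\<pi> x) * ennreal (\<pi> y))"
    by (intro distributed_joint_indep lborel.sigma_finite_measure_axioms X_distr assms)
  have sets: "{z \<in> space (lborel \<Otimes>\<^sub>M lborel). fst z \<noteq> (snd z :: real)} \<in> sets (lborel \<Otimes>\<^sub>M lborel)"
    by measurable
  have "AE z in (lborel \<Otimes>\<^sub>M lborel). fst z \<noteq> (snd z :: real)"
    by (rule lborel_pair.AE_pair_measure[OF sets])
       (auto intro!: AE_I2 eventually_mono[OF AE_lborel_singleton])
  then have "AE \<omega> in M. fst (X j \<omega>, X k \<omega>) \<noteq> snd (X j \<omega>, X k \<omega>)"
    by (subst distributed_AE2[OF joint]) (auto elim: eventually_mono)
  then show ?thesis by simp
qed

text \<open>
  The weights are functions of the design and can be pulled out of the conditional second moments of the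
  errors. The errors themselves need not be square integrable, since \<open>s2\<close> is bounded on the window only;
  it is the weights, supported on the window, that make the products integrable.
\<close>

lemma weighted_noise_tail:
  fixes g e :: "nat \<Rightarrow> 'w \<Rightarrow> real" and s2 :: "real \<Rightarrow> real"
  assumes F: "subalgebra M F"
    and g: "\<And>j. j < m \<Longrightarrow> g j \<in> borel_measurable F"
    and e: "\<And>j. j < m \<Longrightarrow> e j \<in> borel_measurable M"
    and g_le: "\<And>j \<omega>. j < m \<Longrightarrow> \<omega> \<in> space M \<Longrightarrow> \<bar>g j \<omega>\<bar> \<le> b * indicator {t - h..t + h} (X j \<omega>)"
    and var: "\<And>j. j < m \<Longrightarrow>
        AE \<omega> in M. nn_cond_exp M F (\<lambda>\<omega>. ennreal ((e j \<omega>)\<^sup>2)) \<omega> = ennreal (s2 (X j \<omega>))"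
    and s2: "\<And>j. j < m \<Longrightarrow> AE \<omega> in M. \<bar>X j \<omega> - t\<bar> \<le> h \<longrightarrow> s2 (X j \<omega>) \<le> s1"
    and cov: "\<And>j k. j < m \<Longrightarrow> k < m \<Longrightarrow> j \<noteq> k \<Longrightarrow>
        AE \<omega> in M. real_cond_exp M F (\<lambda>\<omega>. e j \<omega> * e k \<omega>) \<omega> = noise_cov s2 (X j \<omega>) (X k \<omega>)"
    and s1: "0 \<le> s1" and r: "0 < r"
  shows "prob {\<omega> \<in> space M. \<bar>\<Sum>j<m. g j \<omega> * e j \<omega>\<bar> \<ge> r} \<le> 2 * m * h * \<pi>1 * b\<^sup>2 * s1 / r\<^sup>2"
proof -
  interpret F: finite_measure_subalgebra M F by unfold_locales (rule F)
  note gM = measurable_from_subalg[OF F g]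
  have mom: "integrable M (\<lambda>\<omega>. (g j \<omega> * e j \<omega>)\<^sup>2)"
    "expectation (\<lambda>\<omega>. (g j \<omega> * e j \<omega>)\<^sup>2) \<le> 2 * h * \<pi>1 * b\<^sup>2 * s1" if j: "j < m" for j
  proof -
    note [measurable] = g[OF j] gM[OF j] e[OF j] X_measurable[OF j]
    have "(\<integral>\<^sup>+\<omega>. ennreal ((g j \<omega> * e j \<omega>)\<^sup>2) \<partial>M)
        = (\<integral>\<^sup>+\<omega>. ennreal ((g j \<omega>)\<^sup>2) * ennreal ((e j \<omega>)\<^sup>2) \<partial>M)"
      by (intro nn_integral_cong) (simp add: power_mult_distrib ennreal_mult)
    also have "\<dots> = (\<integral>\<^sup>+\<omega>. ennreal ((g j \<omega>)\<^sup>2) * nn_cond_exp M F (\<lambda>\<omega>. ennreal ((e j \<omega>)\<^sup>2)) \<omega> \<partial>M)"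
      by (rule F.nn_cond_exp_intg[symmetric]) measurable
    also have "\<dots> \<le> (\<integral>\<^sup>+\<omega>. ennreal (b\<^sup>2 * s1) * indicator {\<omega> \<in> space M. \<bar>X j \<omega> - t\<bar> \<le> h} \<omega> \<partial>M)"
    proof (rule nn_integral_mono_AE)
      show "AE \<omega> in M. ennreal ((g j \<omega>)\<^sup>2) * nn_cond_exp M F (\<lambda>\<omega>. ennreal ((e j \<omega>)\<^sup>2)) \<omega>
          \<le> ennreal (b\<^sup>2 * s1) * indicator {\<omega> \<in> space M. \<bar>X j \<omega> - t\<bar> \<le> h} \<omega>"
        using var[OF j] s2[OF j] AE_space
      proof eventually_elim
        case (elim \<omega>)
        have gb: "(g j \<omega>)\<^sup>2 \<le> (b * indicator {t - h..t + h} (X j \<omega>))\<^sup>2"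
          using power_mono[OF g_le[OF j elim(3)], of 2] by simp
        show ?case
        proof (cases "\<bar>X j \<omega> - t\<bar> \<le> h")
          case True
          then have "X j \<omega> \<in> {t - h..t + h}" by (auto simp: abs_le_iff)
          then have "(g j \<omega>)\<^sup>2 \<le> b\<^sup>2" using gb by simp
          then have "ennreal ((g j \<omega>)\<^sup>2) * ennreal (s2 (X j \<omega>)) \<le> ennreal (b\<^sup>2) * ennreal s1"
            using elim True by (intro mult_mono ennreal_leI) auto
          then show ?thesis using elim True s1 by (simp add: ennreal_mult)
        next
          case False
          then have "(g j \<omega>)\<^sup>2 \<le> 0" using gb by (auto simp: indicator_def abs_le_iff split: if_splits)
          then show ?thesis by simp
        qed
      qed
    qed
    also have "\<dots> = ennreal (b\<^sup>2 * s1) * emeasure M {\<omega> \<in> space M. \<bar>X j \<omega> - t\<bar> \<le> h}"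
      by (rule nn_integral_cmult_indicator) measurable
    also have "\<dots> \<le> ennreal (b\<^sup>2 * s1) * ennreal (2 * h * \<pi>1)"
      unfolding emeasure_eq_measure by (intro mult_left_mono ennreal_leI prob_window[OF j]) simp
    also have "\<dots> = ennreal (2 * h * \<pi>1 * b\<^sup>2 * s1)"
      using s1 h_pos pi1_nonneg by (simp add: ennreal_mult[symmetric] mult_ac)
    finally have le: "(\<integral>\<^sup>+\<omega>. ennreal ((g j \<omega> * e j \<omega>)\<^sup>2) \<partial>M) \<le> ennreal (2 * h * \<pi>1 * b\<^sup>2 * s1)" .
    show int: "integrable M (\<lambda>\<omega>. (g j \<omega> * e j \<omega>)\<^sup>2)"
      by (rule integrableI_nonneg) (use le in \<open>auto intro: le_less_trans\<close>)
    show "expectation (\<lambda>\<omega>. (g j \<omega> * e j \<omega>)\<^sup>2) \<le> 2 * h * \<pi>1 * b\<^sup>2 * s1"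
      using le s1 h_pos pi1_nonneg nn_integral_eq_integral[OF int] by simp
  qed
  have orth: "expectation (\<lambda>\<omega>. (g j \<omega> * e j \<omega>) * (g k \<omega> * e k \<omega>)) = 0"
    if jk: "j < m" "k < m" "j \<noteq> k" for j k
  proof -
    note [measurable] = g[OF jk(1)] g[OF jk(2)] e[OF jk(1)] e[OF jk(2)] gM[OF jk(1)] gM[OF jk(2)]
    have int: "integrable M (\<lambda>\<omega>. (g j \<omega> * g k \<omega>) * (e j \<omega> * e k \<omega>))"
    proof (rule Bochner_Integration.integrable_bound)
      show "integrable M (\<lambda>\<omega>. (g j \<omega> * e j \<omega>)\<^sup>2 + (g k \<omega> * e k \<omega>)\<^sup>2)" using mom jk by simp
      show "AE \<omega> in M. norm ((g j \<omega> * g k \<omega>) * (e j \<omega> * e k \<omega>))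
          \<le> norm ((g j \<omega> * e j \<omega>)\<^sup>2 + (g k \<omega> * e k \<omega>)\<^sup>2)"
      proof (rule AE_I2)
        fix \<omega>
        have "2 * (\<bar>g j \<omega> * e j \<omega>\<bar> * \<bar>g k \<omega> * e k \<omega>\<bar>) \<le> (g j \<omega> * e j \<omega>)\<^sup>2 + (g k \<omega> * e k \<omega>)\<^sup>2"
          using zero_le_power2[of "\<bar>g j \<omega> * e j \<omega>\<bar> - \<bar>g k \<omega> * e k \<omega>\<bar>"] by (simp add: power2_diff)
        moreover have "0 \<le> \<bar>g j \<omega> * e j \<omega>\<bar> * \<bar>g k \<omega> * e k \<omega>\<bar>" by simp
        moreover have "\<bar>g j \<omega> * e j \<omega>\<bar> * \<bar>g k \<omega> * e k \<omega>\<bar> = \<bar>(g j \<omega> * g k \<omega>) * (e j \<omega> * e k \<omega>)\<bar>"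
          by (simp add: abs_mult mult_ac)
        ultimately show "norm ((g j \<omega> * g k \<omega>) * (e j \<omega> * e k \<omega>))
            \<le> norm ((g j \<omega> * e j \<omega>)\<^sup>2 + (g k \<omega> * e k \<omega>)\<^sup>2)"
          unfolding real_norm_def by linarith
      qed
    qed measurable
    have "expectation (\<lambda>\<omega>. (g j \<omega> * e j \<omega>) * (g k \<omega> * e k \<omega>))
        = expectation (\<lambda>\<omega>. (g j \<omega> * g k \<omega>) * (e j \<omega> * e k \<omega>))"
      by (simp add: mult_ac)
    also have "\<dots> = expectation (\<lambda>\<omega>. (g j \<omega> * g k \<omega>) * real_cond_exp M F (\<lambda>\<omega>. e j \<omega> * e k \<omega>) \<omega>)"
      by (rule F.real_cond_exp_intg(2)[OF int, symmetric]) measurable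
    also have "\<dots> = 0"
    proof (rule integral_eq_zero_AE)
      show "AE \<omega> in M. (g j \<omega> * g k \<omega>) * real_cond_exp M F (\<lambda>\<omega>. e j \<omega> * e k \<omega>) \<omega> = 0"
        using cov[OF jk] AE_X_distinct[OF jk] by eventually_elim (simp add: noise_cov_def)
    qed
    finally show ?thesis .
  qed
  have "prob {\<omega> \<in> space M. \<bar>\<Sum>j<m. g j \<omega> * e j \<omega>\<bar> \<ge> r}
      \<le> (\<Sum>j<m. expectation (\<lambda>\<omega>. (g j \<omega> * e j \<omega>)\<^sup>2)) / r\<^sup>2"
    by (rule orthogonal_sum_tail) (use gM e mom orth r in \<open>auto intro!: borel_measurable_times\<close>)
  also have "\<dots> \<le> (\<Sum>j<m. 2 * h * \<pi>1 * b\<^sup>2 * s1) / r\<^sup>2"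
    by (intro divide_right_mono sum_mono mom) auto
  also have "\<dots> = 2 * m * h * \<pi>1 * b\<^sup>2 * s1 / r\<^sup>2" by (simp add: mult_ac)
  finally show ?thesis .
qed

lemma window_count_tail:
  assumes T: "0 < T"
  shows "prob {\<omega> \<in> space M. m * h * T \<le> (\<Sum>j<m. indicator {t - h..t + h} (X j \<omega>))} \<le> 2 * \<pi>1 / T"
proof -
  have int: "integrable M (\<lambda>\<omega>. indicator {t - h..t + h} (X j \<omega>) :: real)" if "j < m" for j
    by (rule integrable_const_bound[where B = 1]) (use X_measurable[OF that] in \<open>auto simp: indicator_def\<close>)
  have ex: "expectation (\<lambda>\<omega>. indicator {t - h..t + h} (X j \<omega>)) \<le> 2 * h * \<pi>1" if j: "j < m" for j
  proof -
    have "expectation (\<lambda>\<omega>. indicator {t - h..t + h} (X j \<omega>))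
        = expectation (indicator {\<omega> \<in> space M. \<bar>X j \<omega> - t\<bar> \<le> h})"
      by (rule Bochner_Integration.integral_cong) (auto simp: indicator_def abs_le_iff)
    also have "\<dots> = prob {\<omega> \<in> space M. \<bar>X j \<omega> - t\<bar> \<le> h}"
      using X_measurable[OF j] by simp
    finally show ?thesis using prob_window[OF j] by simp
  qed
  have "prob {\<omega> \<in> space M. m * h * T \<le> (\<Sum>j<m. indicator {t - h..t + h} (X j \<omega>))}
      \<le> expectation (\<lambda>\<omega>. \<Sum>j<m. indicator {t - h..t + h} (X j \<omega>)) / (m * h * T)"
    by (rule integral_Markov_inequality_measure[where A = "{}"])
       (use m_pos h_pos T int in \<open>auto intro!: Bochner_Integration.integrable_sum sum_nonneg\<close>)
  also have "\<dots> \<le> (\<Sum>j<m. 2 * h * \<pi>1) / (m * h * T)"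
  proof (rule divide_right_mono)
    have "expectation (\<lambda>\<omega>. \<Sum>j<m. indicator {t - h..t + h} (X j \<omega>) :: real)
        = (\<Sum>j<m. expectation (\<lambda>\<omega>. indicator {t - h..t + h} (X j \<omega>) :: real))"
      by (rule Bochner_Integration.integral_sum) (use int in auto)
    also have "\<dots> \<le> (\<Sum>j<m. 2 * h * \<pi>1)" by (rule sum_mono) (use ex in auto)
    finally show "expectation (\<lambda>\<omega>. \<Sum>j<m. indicator {t - h..t + h} (X j \<omega>) :: real) \<le> (\<Sum>j<m. 2 * h * \<pi>1)" .
  qed (use h_pos T in simp)
  also have "\<dots> = 2 * \<pi>1 / T" using m_pos h_pos by simp
  finally show ?thesis .
qed

text \<open>
  Because the weights reproduce polynomials, subtracting the polynomial with coefficients \<open>a\<close> from the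
  responses changes the value of the smoother by \<open>a 0\<close>. What remains is the smoothed remainder, bounded
  by \<open>D\<close> times the sum of the absolute weights, and the smoothed noise.
\<close>

lemma lpk_error_decomposition:
  fixes x y e :: "nat \<Rightarrow> real" and a :: "nat \<Rightarrow> real"
  assumes \<kappa>: "0 < \<kappa>"
    and coer: "\<And>q. \<kappa> * (\<Sum>k\<le>p. (q k)\<^sup>2)
                 \<le> (\<Sum>k\<le>p. \<Sum>l\<le>p. q k * q l * local_moment K h m x t (k + l))"
    and taylor: "\<And>j. j < m \<Longrightarrow> \<bar>x j - t\<bar> \<le> h \<Longrightarrow> \<bar>y j - (\<Sum>k\<le>p. a k * (x j - t) ^ k)\<bar> \<le> D"
  shows "\<bar>lpk_weight p K h m x t j\<bar> \<le> real (p + 1) * B / \<kappa> / (m * h) * indicator {t - h..t + h} (x j)"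
    and "\<bar>lpk p K h m x (\<lambda>j. y j + e j) t - a 0\<bar>
      \<le> real (p + 1) * B / \<kappa> * D / (m * h) * (\<Sum>j<m. indicator {t - h..t + h} (x j))
        + \<bar>\<Sum>j<m. lpk_weight p K h m x t j * e j\<bar>"
proof -
  let ?w = "lpk_weight p K h m x t" and ?b = "real (p + 1) * B / \<kappa> / (m * h)"
  note nz = lpk_coercive_gram(1)[OF h_pos m_pos \<kappa> coer]
  show wb: "\<bar>?w j\<bar> \<le> ?b * indicator {t - h..t + h} (x j)" for j
  proof (cases "\<bar>x j - t\<bar> \<le> h")
    case True
    have "\<bar>?w j\<bar> \<le> real (p + 1) * \<bar>K ((x j - t) / h)\<bar> / (\<kappa> * real m * h)"
      by (rule lpk_coercive_gram(2)[OF h_pos m_pos \<kappa> coer True])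
    also have "\<dots> \<le> real (p + 1) * B / (\<kappa> * real m * h)"
      using K_nonneg K_le \<kappa> h_pos by (intro divide_right_mono mult_left_mono) auto
    finally show ?thesis using True by (auto simp: indicator_def abs_le_iff mult.assoc)
  next
    case False
    then have "(x j - t) / h \<notin> {-1..1}" using h_pos by (auto simp: field_simps)
    then have "K ((x j - t) / h) = 0" by (rule K_outside)
    then show ?thesis using B_nonneg h_pos \<kappa> by (simp add: lpk_weight_def)
  qed
  have "(\<Sum>j<m. ?w j * (\<Sum>k\<le>p. a k * (x j - t) ^ k)) = (\<Sum>k\<le>p. a k * (\<Sum>j<m. ?w j * (x j - t) ^ k))"
    by (simp add: sum_distrib_left sum.swap[of _ "{..p}"] mult_ac)
  also have "\<dots> = (\<Sum>k\<le>p. if k = 0 then a k else 0)"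
    by (rule sum.cong) (auto simp: lpk_weights_reproduce_polynomials[OF nz])
  finally have rep: "(\<Sum>j<m. ?w j * (\<Sum>k\<le>p. a k * (x j - t) ^ k)) = a 0" by simp
  have "lpk p K h m x (\<lambda>j. y j + e j) t - a 0
      = (\<Sum>j<m. ?w j * (y j - (\<Sum>k\<le>p. a k * (x j - t) ^ k))) + (\<Sum>j<m. ?w j * e j)"
    unfolding lpk_eq_weighted_sum using rep
    by (simp add: algebra_simps sum.distrib sum_subtractf)
  moreover have "\<bar>\<Sum>j<m. ?w j * (y j - (\<Sum>k\<le>p. a k * (x j - t) ^ k))\<bar>
      \<le> (\<Sum>j<m. ?b * D * indicator {t - h..t + h} (x j))"
  proof (intro order_trans[OF sum_abs] sum_mono)
    fix j assume "j \<in> {..<m}"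
    then have j: "j < m" by simp
    show "\<bar>?w j * (y j - (\<Sum>k\<le>p. a k * (x j - t) ^ k))\<bar> \<le> ?b * D * indicator {t - h..t + h} (x j)"
    proof (cases "\<bar>x j - t\<bar> \<le> h")
      case True
      then have mem: "x j \<in> {t - h..t + h}" by (auto simp: abs_le_iff)
      have "\<bar>?w j\<bar> * \<bar>y j - (\<Sum>k\<le>p. a k * (x j - t) ^ k)\<bar> \<le> ?b * D"
        using wb[of j] taylor[OF j True] mem B_nonneg \<kappa> h_pos by (intro mult_mono) auto
      then show ?thesis using mem by (simp add: abs_mult)
    next
      case False
      then have "?w j = 0" using wb[of j] by (auto simp: indicator_def abs_le_iff split: if_splits)
      then show ?thesis using False by (auto simp: indicator_def abs_le_iff)
    qed
  qed
  ultimately show "\<bar>lpk p K h m x (\<lambda>j. y j + e j) t - a 0\<bar>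
      \<le> real (p + 1) * B / \<kappa> * D / (m * h) * (\<Sum>j<m. indicator {t - h..t + h} (x j))
        + \<bar>\<Sum>j<m. ?w j * e j\<bar>"
    unfolding sum_distrib_left[symmetric] by (simp add: mult.assoc)
qed

text \<open>
  The exceptional events are: no Taylor bound is available (outside \<open>E\<close>), the window is overcrowded, some
  empirical moment is far from its mean, or the smoothed noise is large. Outside of them the decomposition
  of the error gives the bound.
\<close>

lemma lpk_error_tail:
  fixes f :: "'w \<Rightarrow> real \<Rightarrow> real" and e :: "nat \<Rightarrow> 'w \<Rightarrow> real"
  assumes \<kappa>: "0 < \<kappa>"
    and coer: "\<And>q. 2 * \<kappa> * (\<Sum>k\<le>p. (q k)\<^sup>2) \<le> (\<Sum>k\<le>p. \<Sum>l\<le>p. q k * q l * kernel_mean (k + l))"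
    and F: "subalgebra M F"
    and XF: "\<And>j. j < m \<Longrightarrow> X j \<in> borel_measurable F"
    and e: "\<And>j. j < m \<Longrightarrow> e j \<in> borel_measurable M"
    and var: "\<And>j. j < m \<Longrightarrow>
        AE \<omega> in M. nn_cond_exp M F (\<lambda>\<omega>. ennreal ((e j \<omega>)\<^sup>2)) \<omega> = ennreal (s2 (X j \<omega>))"
    and s2: "\<And>j. j < m \<Longrightarrow> AE \<omega> in M. \<bar>X j \<omega> - t\<bar> \<le> h \<longrightarrow> s2 (X j \<omega>) \<le> s1"
    and cov: "\<And>j k. j < m \<Longrightarrow> k < m \<Longrightarrow> j \<noteq> k \<Longrightarrow>
        AE \<omega> in M. real_cond_exp M F (\<lambda>\<omega>. e j \<omega> * e k \<omega>) \<omega> = noise_cov s2 (X j \<omega>) (X k \<omega>)"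
    and s1: "0 \<le> s1" and r: "0 < r" and T: "0 < T" and D: "0 \<le> D"
    and E: "E \<in> events"
    and taylor: "\<And>\<omega>. \<omega> \<in> E \<Longrightarrow> \<exists>a. a 0 = f \<omega> t \<and> (\<forall>j<m. \<bar>X j \<omega> - t\<bar> \<le> h \<longrightarrow>
        \<bar>f \<omega> (X j \<omega>) - (\<Sum>k\<le>p. a k * (X j \<omega> - t) ^ k)\<bar> \<le> D)"
  defines "b \<equiv> real (p + 1) * B / \<kappa>"
  shows "prob {\<omega> \<in> space M. \<bar>lpk p K h m (\<lambda>j. X j \<omega>) (\<lambda>j. f \<omega> (X j \<omega>) + e j \<omega>) t - f \<omega> t\<bar> > b * D * T + r}
    \<le> (1 - prob E) + 2 * \<pi>1 / T
      + (real (2 * p + 1) * (2 * B\<^sup>2 * \<pi>1 / (\<kappa> / real (p + 1))\<^sup>2) + 2 * \<pi>1 * b\<^sup>2 * s1 / r\<^sup>2) / (m * h)"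
proof -
  let ?\<epsilon> = "\<kappa> / real (p + 1)"
  let ?A = "\<lambda>\<omega>. local_moment K h m (\<lambda>j. X j \<omega>) t"
  let ?w = "\<lambda>\<omega>. lpk_weight p K h m (\<lambda>j. X j \<omega>) t"
  have b0: "0 \<le> b" using B_nonneg \<kappa> by (simp add: b_def)
  have \<epsilon>: "0 < ?\<epsilon>" using \<kappa> by simp
  have A_F: "(\<lambda>\<omega>. ?A \<omega> s) \<in> borel_measurable F" for s
    unfolding local_moment_kernel_power using XF
    by (intro borel_measurable_divide borel_measurable_sum measurable_compose[OF _ kernel_power_measurable]) auto
  have space: "space F = space M" using F by (simp add: subalgebra_def)
  define G where "G = {\<omega> \<in> space M. \<forall>s\<in>{..2 * p}. \<bar>?A \<omega> s - kernel_mean s\<bar> < ?\<epsilon>}"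
  have GF: "G \<in> sets F"
    unfolding G_def space[symmetric] using A_F by measurable
  have GM: "G \<in> events" using GF F by (auto simp: subalgebra_def)
  have coerG: "\<kappa> * (\<Sum>k\<le>p. (q k)\<^sup>2) \<le> (\<Sum>k\<le>p. \<Sum>l\<le>p. q k * q l * ?A \<omega> (k + l))"
    if "\<omega> \<in> G" for \<omega> q
    by (rule coercive_if_moments_close[OF coer]) (use that in \<open>auto simp: G_def intro: less_imp_le\<close>)
  \<comment> \<open>Cutting the weights off outside of the design event \<open>G\<close> keeps them measurable in the design and makes
      them bounded everywhere, which the second moment of the noise requires.\<close>
  define g where "g j \<omega> = indicator G \<omega> * ?w \<omega> j" for j \<omega>
  have gF: "g j \<in> borel_measurable F" if "j < m" for j
    unfolding g_def[abs_def] using GF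
    by (intro borel_measurable_times borel_measurable_lpk_weight XF that) auto
  have g_le: "\<bar>g j \<omega>\<bar> \<le> b / (m * h) * indicator {t - h..t + h} (X j \<omega>)" for j \<omega>
  proof (cases "\<omega> \<in> G")
    case True
    then show ?thesis
      using lpk_error_decomposition(1)[OF \<kappa> coerG[OF True], of "\<lambda>j. \<Sum>k\<le>p. 0 * (X j \<omega> - t) ^ k" "\<lambda>_. 0" 0 j]
      by (simp add: g_def b_def)
  next
    case False
    then show ?thesis using b0 h_pos by (simp add: g_def)
  qed
  let ?N1 = "{\<omega> \<in> space M. \<bar>\<Sum>j<m. g j \<omega> * e j \<omega>\<bar> \<ge> r}"
  let ?N2 = "{\<omega> \<in> space M. m * h * T \<le> (\<Sum>j<m. indicator {t - h..t + h} (X j \<omega>))}"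
  let ?N3 = "\<lambda>s. {\<omega> \<in> space M. \<bar>?A \<omega> s - kernel_mean s\<bar> \<ge> ?\<epsilon>}"
  have N1: "?N1 \<in> events"
    using measurable_from_subalg[OF F gF] e by measurable
  have N2: "?N2 \<in> events" using X_measurable by measurable
  have N3: "?N3 s \<in> events" for s using measurable_from_subalg[OF F A_F] by measurable
  have sub: "{\<omega> \<in> space M. \<bar>lpk p K h m (\<lambda>j. X j \<omega>) (\<lambda>j. f \<omega> (X j \<omega>) + e j \<omega>) t - f \<omega> t\<bar> > b * D * T + r}
      \<subseteq> (space M - E) \<union> (?N2 \<union> ((\<Union>s\<in>{..2 * p}. ?N3 s) \<union> ?N1))"
  proof (rule subsetI, rule ccontr)
    fix \<omega>
    assume "\<omega> \<in> {\<omega> \<in> space M. \<bar>lpk p K h m (\<lambda>j. X j \<omega>) (\<lambda>j. f \<omega> (X j \<omega>) + e j \<omega>) t - f \<omega> t\<bar> > b * D * T + r}"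
      and out: "\<omega> \<notin> (space M - E) \<union> (?N2 \<union> ((\<Union>s\<in>{..2 * p}. ?N3 s) \<union> ?N1))"
    then have \<omega>: "\<omega> \<in> space M"
      and big: "\<bar>lpk p K h m (\<lambda>j. X j \<omega>) (\<lambda>j. f \<omega> (X j \<omega>) + e j \<omega>) t - f \<omega> t\<bar> > b * D * T + r" by auto
    have inE: "\<omega> \<in> E" and inG: "\<omega> \<in> G"
      and small: "\<bar>\<Sum>j<m. g j \<omega> * e j \<omega>\<bar> < r"
      and few: "(\<Sum>j<m. indicator {t - h..t + h} (X j \<omega>)) < m * h * T"
      using out \<omega> by (auto simp: G_def not_le)
    obtain a where a: "a 0 = f \<omega> t" "\<And>j. j < m \<Longrightarrow> \<bar>X j \<omega> - t\<bar> \<le> h \<Longrightarrow>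
        \<bar>f \<omega> (X j \<omega>) - (\<Sum>k\<le>p. a k * (X j \<omega> - t) ^ k)\<bar> \<le> D"
      using taylor[OF inE] by blast
    have "\<bar>lpk p K h m (\<lambda>j. X j \<omega>) (\<lambda>j. f \<omega> (X j \<omega>) + e j \<omega>) t - a 0\<bar>
      \<le> b * D / (m * h) * (\<Sum>j<m. indicator {t - h..t + h} (X j \<omega>)) + \<bar>\<Sum>j<m. ?w \<omega> j * e j \<omega>\<bar>"
      unfolding b_def by (rule lpk_error_decomposition(2)[OF \<kappa> coerG[OF inG] a(2)]) 
    also have "b * D / (m * h) * (\<Sum>j<m. indicator {t - h..t + h} (X j \<omega>)) \<le> b * D / (m * h) * (m * h * T)"
      using few b0 D h_pos by (intro mult_left_mono) auto
    also have "b * D / (m * h) * (m * h * T) = b * D * T" using m_pos h_pos by simp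
    also have "(\<Sum>j<m. ?w \<omega> j * e j \<omega>) = (\<Sum>j<m. g j \<omega> * e j \<omega>)" using inG by (simp add: g_def)
    finally show False using big small a(1) by simp
  qed
  have "prob {\<omega> \<in> space M. \<bar>lpk p K h m (\<lambda>j. X j \<omega>) (\<lambda>j. f \<omega> (X j \<omega>) + e j \<omega>) t - f \<omega> t\<bar> > b * D * T + r}
      \<le> prob ((space M - E) \<union> (?N2 \<union> ((\<Union>s\<in>{..2 * p}. ?N3 s) \<union> ?N1)))"
    by (rule finite_measure_mono[OF sub]) (use E N1 N2 N3 in auto)
  also have "\<dots> \<le> prob (space M - E) + (prob ?N2 + (prob (\<Union>s\<in>{..2 * p}. ?N3 s) + prob ?N1))"
  proof -
    have N3': "(\<Union>s\<in>{..2 * p}. ?N3 s) \<in> events" by (rule sets.finite_UN) (use N3 in auto)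
    note U = sets.Un[OF N3' N1]
    note V = sets.Un[OF N2 U]
    show ?thesis
      using measure_Un_le[OF sets.compl_sets[OF E] V] measure_Un_le[OF N2 U] measure_Un_le[OF N3' N1]
      by linarith
  qed
  also have "prob (\<Union>s\<in>{..2 * p}. ?N3 s) \<le> (\<Sum>s\<in>{..2 * p}. prob (?N3 s))"
    by (rule finite_measure_subadditive_finite) (use N3 in auto)
  also have "\<dots> \<le> (\<Sum>s\<in>{..2 * p}. 2 * B\<^sup>2 * \<pi>1 / (m * h * ?\<epsilon>\<^sup>2))"
    by (intro sum_mono local_moment_concentration \<epsilon>)
  also have "prob (space M - E) = 1 - prob E" by (rule prob_compl[OF E])
  also have "prob ?N2 \<le> 2 * \<pi>1 / T" by (rule window_count_tail[OF T])
  also have "prob ?N1 \<le> 2 * m * h * \<pi>1 * (b / (m * h))\<^sup>2 * s1 / r\<^sup>2"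
    by (rule weighted_noise_tail[OF F gF e g_le var s2 cov s1 r])
  also have "2 * m * h * \<pi>1 * (b / (m * h))\<^sup>2 * s1 / r\<^sup>2 = 2 * \<pi>1 * b\<^sup>2 * s1 / r\<^sup>2 / (m * h)"
    using m_pos h_pos by (simp add: power_divide power2_eq_square mult_ac)
  also have "(\<Sum>s\<in>{..2 * p}. 2 * B\<^sup>2 * \<pi>1 / (m * h * ?\<epsilon>\<^sup>2)) = real (2 * p + 1) * (2 * B\<^sup>2 * \<pi>1 / ?\<epsilon>\<^sup>2) / (m * h)"
    by (simp add: mult_ac)
  finally show ?thesis by (simp add: add_divide_distrib add_ac)
qed

end

section \<open>Taylor bounds common to all individuals\<close>

text \<open>
  For a function with \<open>k\<close> continuous derivatives on an interval, this is the \<open>k\<close>-th derivative at every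
  inner point. Unlike the derivative, it is defined for all functions by countably many limits of values
  at points, and so it is a measurable functional of a path in the product space.
\<close>

primrec right_deriv :: "nat \<Rightarrow> (real \<Rightarrow> real) \<Rightarrow> real \<Rightarrow> real" where
  "right_deriv 0 g x = g x"
| "right_deriv (Suc k) g x =
     lim (\<lambda>n. (right_deriv k g (x + 1 / Suc n) - right_deriv k g x) / (1 / Suc n))"

lemma right_deriv_eq:
  assumes D: "\<And>l x. l < k \<Longrightarrow> x \<in> {c..d} \<Longrightarrow> (D l has_real_derivative D (Suc l) x) (at x within {c..d})"
    and D0: "\<And>x. x \<in> {c..d} \<Longrightarrow> D 0 x = g x"
    and "l \<le> k" "x \<in> {c<..<d}"
  shows "right_deriv l g x = D l x"
  using \<open>l \<le> k\<close> \<open>x \<in> {c<..<d}\<close>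
proof (induction l arbitrary: x)
  case 0
  then show ?case using D0 by simp
next
  case (Suc l)
  have small: "(\<lambda>n. x + 1 / Suc n) \<longlonglongrightarrow> x"
    using tendsto_add[OF tendsto_const[of x] LIMSEQ_inverse_real_of_nat] by (simp add: inverse_eq_divide)
  have ev: "\<forall>\<^sub>F n in sequentially. x + 1 / Suc n \<in> {c<..<d}"
    by (rule topological_tendstoD[OF small]) (use Suc.prems in auto)
  have "filterlim (\<lambda>n. x + 1 / Suc n) (at x within {c..d}) sequentially"
    unfolding filterlim_at using small ev by (auto elim!: eventually_mono)
  moreover have "((\<lambda>y. (D l y - D l x) / (y - x)) \<longlongrightarrow> D (Suc l) x) (at x within {c..d})"
    using D[of l x] Suc.prems by (simp add: has_field_derivative_iff)
  ultimately have "(\<lambda>n. (D l (x + 1 / Suc n) - D l x) / (x + 1 / Suc n - x)) \<longlonglongrightarrow> D (Suc l) x"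
    using filterlim_compose by blast
  moreover have "\<forall>\<^sub>F n in sequentially. (D l (x + 1 / Suc n) - D l x) / (x + 1 / Suc n - x)
      = (right_deriv l g (x + 1 / Suc n) - right_deriv l g x) / (1 / Suc n)"
    using ev by eventually_elim (use Suc in simp)
  ultimately have "(\<lambda>n. (right_deriv l g (x + 1 / Suc n) - right_deriv l g x) / (1 / Suc n)) \<longlonglongrightarrow> D (Suc l) x"
    by (rule Lim_transform_eventually)
  then show ?case by (simp add: limI)
qed

lemma borel_measurable_right_deriv:
  assumes "\<And>x. (\<lambda>w. g w x) \<in> borel_measurable M"
  shows "(\<lambda>w. right_deriv k (g w) x) \<in> borel_measurable M"
proof (induction k arbitrary: x)
  case (Suc k)
  note [measurable] = Suc
  show ?case unfolding right_deriv.simps by measurable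
qed (simp add: assms)

lemma closure_Rats_Int_open_interval:
  assumes "c < (d::real)"
  shows "closure ({c<..<d} \<inter> \<rat>) = {c..d}"
  using closure_open_Int_superset[of "{c<..<d}" \<rat>] assms by (simp add: Rats_closure_real)

lemma Taylor_of_bounded_derivative:
  fixes D :: "nat \<Rightarrow> real \<Rightarrow> real"
  assumes D: "\<And>l x. l \<le> p \<Longrightarrow> x \<in> {c..d} \<Longrightarrow> (D l has_real_derivative D (Suc l) x) (at x within {c..d})"
    and L: "\<And>x. x \<in> {c..d} \<Longrightarrow> \<bar>D (Suc p) x\<bar> \<le> L"
    and t: "t \<in> {c..d}" and x: "x \<in> {c..d}"
  shows "\<bar>D 0 x - (\<Sum>k\<le>p. D k t / fact k * (x - t) ^ k)\<bar> \<le> L * \<bar>x - t\<bar> ^ (p + 1)"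
proof -
  have "0 \<le> L" using L[OF t] by linarith
  have "norm (D 0 x - (\<Sum>k\<le>p. D k t * (x - t) ^ k / fact k)) \<le> L * norm (x - t) ^ Suc p / fact p"
    by (rule field_Taylor[where S = "{c..d}"]) (use D L t x in auto)
  also have "\<dots> \<le> L * norm (x - t) ^ Suc p / 1"
    using \<open>0 \<le> L\<close> by (intro divide_left_mono) (auto simp: fact_ge_1)
  finally show ?thesis by simp
qed

text \<open>
  The largest absolute value of the derivative of order \<open>p + 1\<close> is almost surely finite for each
  individual, but one bound has to do for all of them. By continuity a bound at rational points suffices,
  and there the derivative is a measurable functional of the path; hence the probability that \<open>L\<close> is a bound
  depends on the law of the path alone, which all individuals share. The Taylor polynomials with the
  remainder bounded through \<open>L\<close> are then available outside an event of small probability.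
\<close>

lemma (in prob_space) uniform_Taylor_bound:
  fixes v :: "nat \<Rightarrow> real \<Rightarrow> 'a \<Rightarrow> real"
  assumes ab: "a \<le> c" "c < d" "d \<le> b"
    and v: "\<And>i t. t \<in> {a..b} \<Longrightarrow> v i t \<in> borel_measurable M"
    and ident: "identically_distributed M {a..b} v"
    and smooth: "\<And>i. AE \<omega> in M. times_cont_diff_on (p + 1) {c..d} (\<lambda>t. \<eta> t + v i t \<omega>)"
    and e: "0 < e"
  shows "\<exists>L\<ge>0. \<forall>i. \<exists>E\<in>events. 1 - prob E \<le> e \<and> (\<forall>\<omega>\<in>E. \<forall>t\<in>{c..d}. \<exists>q. q 0 = \<eta> t + v i t \<omega> \<and>
     (\<forall>x\<in>{c..d}. \<bar>\<eta> x + v i x \<omega> - (\<Sum>k\<le>p. q k * (x - t) ^ k)\<bar> \<le> L * \<bar>x - t\<bar> ^ (p + 1)))"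
proof -
  let ?T = "{a..b}"
  \<comment> \<open>Coordinates outside of the index set carry no information, so they are replaced by zero.\<close>
  define G where "G w x = \<eta> x + (if x \<in> ?T then w x else 0)" for w :: "real \<Rightarrow> real" and x
  have G_meas: "(\<lambda>w. G w x) \<in> borel_measurable (path_space ?T)" for x
    unfolding G_def by (cases "x \<in> ?T") auto
  define \<Phi> where "\<Phi> L = {w \<in> space (path_space ?T).
      \<forall>x\<in>{c<..<d} \<inter> \<rat>. \<bar>right_deriv (p + 1) (G w) x\<bar> \<le> real L}" for L :: nat
  have \<Phi>_sets: "\<Phi> L \<in> sets (path_space ?T)" for L
  proof -
    note [measurable] = borel_measurable_right_deriv[of G, OF G_meas]
    have "Measurable.pred (path_space ?T) (\<lambda>w. \<forall>x :: rat. of_rat x \<in> {c<..<d} \<longrightarrow>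
        \<bar>right_deriv (p + 1) (G w) (of_rat x)\<bar> \<le> real L)"
      by measurable
    moreover have "(\<forall>x\<in>{c<..<d} \<inter> \<rat>. P x) \<longleftrightarrow> (\<forall>x :: rat. of_rat x \<in> {c<..<d} \<longrightarrow> P (of_rat x))"
      for P :: "real \<Rightarrow> bool"
      unfolding Rats_def by auto
    ultimately show ?thesis unfolding \<Phi>_def by (simp add: pred_def)
  qed
  have path: "sample_path ?T (v i) \<in> measurable M (path_space ?T)" for i
    unfolding sample_path_def[abs_def] by (rule measurable_restrict) (rule v)
  define A where "A i L = sample_path ?T (v i) -` \<Phi> L \<inter> space M" for i L
  have A_sets [measurable]: "A i L \<in> events" for i L
    unfolding A_def using path \<Phi>_sets by (rule measurable_sets)
  have prob_A: "prob (A i L) = prob (A 0 L)" for i L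
  proof -
    have "distr M (path_space ?T) (sample_path ?T (v i)) = distr M (path_space ?T) (sample_path ?T (v 0))"
      using ident unfolding identically_distributed_def by blast
    then show ?thesis
      unfolding A_def by (metis measure_distr[OF path \<Phi>_sets])
  qed
  have A_iff: "\<omega> \<in> A i L \<longleftrightarrow> \<omega> \<in> space M \<and>
      (\<forall>x\<in>{c<..<d} \<inter> \<rat>. \<bar>right_deriv (p + 1) (G (sample_path ?T (v i) \<omega>)) x\<bar> \<le> real L)" for \<omega> i L
    unfolding A_def \<Phi>_def using measurable_space[OF path] by auto
  have G_path: "G (sample_path ?T (v i) \<omega>) x = \<eta> x + v i x \<omega>" if "x \<in> {c..d}" for i \<omega> x
    using that ab by (auto simp: G_def sample_path_def)
  have derivs: "\<exists>D. (\<forall>x\<in>{c..d}. D 0 x = \<eta> x + v i x \<omega>) \<and>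
      (\<forall>l\<le>p. \<forall>x\<in>{c..d}. (D l has_real_derivative D (Suc l) x) (at x within {c..d})) \<and>
      continuous_on {c..d} (D (Suc p)) \<and>
      (\<forall>x\<in>{c<..<d}. right_deriv (p + 1) (G (sample_path ?T (v i) \<omega>)) x = D (Suc p) x)"
    if sm: "times_cont_diff_on (p + 1) {c..d} (\<lambda>t. \<eta> t + v i t \<omega>)" for i \<omega>
  proof -
    obtain D where D: "\<And>x. x \<in> {c..d} \<Longrightarrow> D 0 x = \<eta> x + v i x \<omega>"
      "\<And>l x. l < p + 1 \<Longrightarrow> x \<in> {c..d} \<Longrightarrow> (D l has_real_derivative D (Suc l) x) (at x within {c..d})"
      "continuous_on {c..d} (D (Suc p))"
      using sm unfolding times_cont_diff_on_def by (metis Suc_eq_plus1 order_refl)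
    have "right_deriv (p + 1) (G (sample_path ?T (v i) \<omega>)) x = D (p + 1) x" if "x \<in> {c<..<d}" for x
      by (rule right_deriv_eq[of "p + 1" c d]) (use D that G_path in auto)
    then show ?thesis using D by (intro exI[of _ D]) auto
  qed
  have "AE \<omega> in M. \<omega> \<in> (\<Union>L. A 0 L)"
    using smooth[of 0] AE_space
  proof eventually_elim
    case (elim \<omega>)
    from derivs[OF elim(1)] obtain D where cont: "continuous_on {c..d} (D (Suc p))"
      and eq: "\<And>x. x \<in> {c<..<d} \<Longrightarrow> right_deriv (p + 1) (G (sample_path ?T (v 0) \<omega>)) x = D (Suc p) x"
      by blast
    have "bounded (D (Suc p) ` {c..d})"
      by (intro compact_imp_bounded compact_continuous_image cont) simp
    then obtain C where C: "\<forall>x\<in>{c..d}. \<bar>D (Suc p) x\<bar> \<le> C"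
      unfolding bounded_iff by auto
    obtain L :: nat where "C \<le> L" using real_arch_simple by blast
    have "\<bar>right_deriv (p + 1) (G (sample_path ?T (v 0) \<omega>)) x\<bar> \<le> real L"
      if x: "x \<in> {c<..<d} \<inter> \<rat>" for x
    proof -
      have "\<bar>D (Suc p) x\<bar> \<le> C" using C x by simp
      then show ?thesis using eq[of x] x \<open>C \<le> L\<close> by (simp del: right_deriv.simps)
    qed
    then have "\<omega> \<in> A 0 L" unfolding A_iff using elim(2) by blast
    then show ?case by blast
  qed
  then have "prob (\<Union>L. A 0 L) = 1" by (subst prob_eq_1) auto
  moreover have "incseq (A 0)"
  proof (intro incseq_SucI subsetI)
    fix L \<omega> assume "\<omega> \<in> A 0 L"
    then show "\<omega> \<in> A 0 (Suc L)"
      unfolding A_iff by (auto intro: order_trans[of _ "real L"] simp del: right_deriv.simps)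
  qed
  then have "(\<lambda>L. prob (A 0 L)) \<longlonglongrightarrow> prob (\<Union>L. A 0 L)"
    by (intro finite_Lim_measure_incseq) auto
  ultimately have "\<forall>\<^sub>F L in sequentially. 1 - e < prob (A 0 L)"
    using e by (intro order_tendstoD) auto
  then obtain L where L: "1 - e < prob (A 0 L)"
    using eventually_happens' sequentially_bot by blast
  show ?thesis
  proof (intro exI[of _ "real L"] conjI allI)
    fix i
    obtain Nu where Nu: "Nu \<in> null_sets M"
      "\<And>\<omega>. \<omega> \<in> space M - Nu \<Longrightarrow> times_cont_diff_on (p + 1) {c..d} (\<lambda>t. \<eta> t + v i t \<omega>)"
      using AE_E3[OF smooth[of i]] by metis
    show "\<exists>E\<in>events. 1 - prob E \<le> e \<and> (\<forall>\<omega>\<in>E. \<forall>t\<in>{c..d}. \<exists>q. q 0 = \<eta> t + v i t \<omega> \<and>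
       (\<forall>x\<in>{c..d}. \<bar>\<eta> x + v i x \<omega> - (\<Sum>k\<le>p. q k * (x - t) ^ k)\<bar> \<le> real L * \<bar>x - t\<bar> ^ (p + 1)))"
    proof (intro bexI[of _ "A i L - Nu"] conjI ballI)
      show "A i L - Nu \<in> events" using Nu by auto
      have "prob (A i L - Nu) = prob (A 0 L)"
        using Nu(1) prob_A[of i L] by (simp add: measure_Diff_null_set)
      then show "1 - prob (A i L - Nu) \<le> e" using L by simp
      fix \<omega> t assume \<omega>: "\<omega> \<in> A i L - Nu" and t: "t \<in> {c..d}"
      then have "times_cont_diff_on (p + 1) {c..d} (\<lambda>t. \<eta> t + v i t \<omega>)"
        by (intro Nu(2)) (auto simp: A_iff)
      from derivs[OF this] obtain D where D0: "\<And>x. x \<in> {c..d} \<Longrightarrow> D 0 x = \<eta> x + v i x \<omega>"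
        and D: "\<And>l x. l \<le> p \<Longrightarrow> x \<in> {c..d} \<Longrightarrow> (D l has_real_derivative D (Suc l) x) (at x within {c..d})"
        and cont: "continuous_on {c..d} (D (Suc p))"
        and eq: "\<And>x. x \<in> {c<..<d} \<Longrightarrow> right_deriv (p + 1) (G (sample_path ?T (v i) \<omega>)) x = D (Suc p) x"
        by blast
      have "\<bar>D (Suc p) x\<bar> \<le> L" if "x \<in> {c..d}" for x
      proof (rule continuous_le_on_closure[where f = "\<lambda>x. \<bar>D (Suc p) x\<bar>" and S = "{c<..<d} \<inter> \<rat>"])
        show "continuous_on (closure ({c<..<d} \<inter> \<rat>)) (\<lambda>x. \<bar>D (Suc p) x\<bar>)"
          unfolding closure_Rats_Int_open_interval[OF ab(2)] by (intro continuous_intros cont)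
        show "x \<in> closure ({c<..<d} \<inter> \<rat>)" unfolding closure_Rats_Int_open_interval[OF ab(2)] by (rule that)
        show "\<bar>D (Suc p) y\<bar> \<le> L" if "y \<in> {c<..<d} \<inter> \<rat>" for y
        proof -
          have "\<bar>right_deriv (p + 1) (G (sample_path ?T (v i) \<omega>)) y\<bar> \<le> L"
            using \<omega> that unfolding A_iff Diff_iff by blast
          then show ?thesis using eq[of y] that by (simp del: right_deriv.simps)
        qed
      qed
      note Taylor_of_bounded_derivative[OF D this t]
      then show "\<exists>q. q 0 = \<eta> t + v i t \<omega> \<and>
         (\<forall>x\<in>{c..d}. \<bar>\<eta> x + v i x \<omega> - (\<Sum>k\<le>p. q k * (x - t) ^ k)\<bar> \<le> real L * \<bar>x - t\<bar> ^ (p + 1))"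
        by (intro exI[of _ "\<lambda>k. D k t / fact k"]) (use D0 t in auto)
    qed
  qed simp
qed

section \<open>Rates and uniform boundedness in probability\<close>

text \<open>
  The bandwidth balances bias and noise: with \<open>r\<close> the rate of the theorem, the bias \<open>h ^ (p + 1)\<close> is \<open>O(r)\<close>,
  and the variance \<open>1 / (N * h)\<close> is \<open>O(r\<^sup>2)\<close> because \<open>n powr \<delta> * h * r\<^sup>2\<close> is bounded away from zero.
\<close>

lemma sampling_rates:
  fixes h r :: "nat \<Rightarrow> real"
  assumes samp: "sampling_condition C \<delta> N h"
    and hrate: "h \<in> \<Theta>(\<lambda>n. real n powr (- \<delta> / (2 * real p + 3)))"
    and r_def: "\<And>n. r n = real n powr (- ((real p + 1) * \<delta> / (2 * real p + 3)))"
  obtains c1 c2 where "0 < c1" "0 < c2"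
    "\<forall>\<^sub>F n in sequentially. h n ^ (p + 1) \<le> c2 * r n"
    "\<forall>\<^sub>F n in sequentially. \<forall>i<n. c1 \<le> N n i * h n * (r n)\<^sup>2"
    "\<And>z. \<forall>\<^sub>F n in sequentially. \<forall>i<n. z \<le> N n i * h n"
proof -
  let ?g = "\<lambda>n. real n powr (- \<delta> / (2 * real p + 3))"
  from samp have C: "0 < C" and N: "\<And>n i. i < n \<Longrightarrow> C * real n powr \<delta> \<le> real (N n i)"
    and h: "\<And>n. 0 < h n" and lim: "filterlim (\<lambda>n. real n powr \<delta> * h n) at_top sequentially"
    unfolding sampling_condition_def by auto
  obtain cu where cu: "0 < cu" "\<forall>\<^sub>F n in sequentially. norm (h n) \<le> cu * norm (?g n)"
    using landau_o.bigE[OF bigthetaD1[OF hrate]] by blast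
  obtain cl where cl: "0 < cl" "\<forall>\<^sub>F n in sequentially. norm (h n) \<ge> cl * norm (?g n)"
    using landau_omega.bigE[OF bigthetaD2[OF hrate]] by blast
  have Nh: "C * (real n powr \<delta> * h n) \<le> N n i * h n" if "i < n" for n i
    using mult_right_mono[OF N[OF that], of "h n"] h[of n] by (simp add: mult.assoc)
  have gr: "?g n ^ (p + 1) = r n" if "0 < n" for n
  proof -
    have "?g n ^ (p + 1) = ?g n powr real (p + 1)"
      by (rule powr_realpow[symmetric]) (use that in simp)
    also have "\<dots> = real n powr (- \<delta> / (2 * real p + 3) * real (p + 1))" by (rule powr_powr)
    also have "- \<delta> / (2 * real p + 3) * real (p + 1) = - ((real p + 1) * \<delta> / (2 * real p + 3))"
      by (simp add: mult.commute add.commute)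
    finally show ?thesis by (simp only: r_def)
  qed
  have nr: "real n powr \<delta> * ?g n * (r n)\<^sup>2 = 1" if "0 < n" for n
  proof -
    define k where "k = 2 * real p + 3"
    have k: "k \<noteq> 0" "real p + 1 = (k - 1) / 2" by (simp_all add: k_def)
    have "real n powr \<delta> * ?g n * (r n)\<^sup>2
        = real n powr (\<delta> + (- \<delta> / k) + (- ((real p + 1) * \<delta> / k) + - ((real p + 1) * \<delta> / k)))"
      unfolding r_def k_def power2_eq_square by (simp only: powr_add)
    also have "\<delta> + (- \<delta> / k) + (- ((real p + 1) * \<delta> / k) + - ((real p + 1) * \<delta> / k)) = 0"
      unfolding k(2) using k(1) by (simp add: field_simps)
    finally show ?thesis using that by simp
  qed
  show thesis
  proof (rule that[of "C * cl" "cu ^ (p + 1)"])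
    show "0 < C * cl" "0 < cu ^ (p + 1)" using C cl cu by simp_all
    show "\<forall>\<^sub>F n in sequentially. h n ^ (p + 1) \<le> cu ^ (p + 1) * r n"
      using cu(2) eventually_gt_at_top[of 0]
    proof eventually_elim
      case (elim n)
      then have "h n ^ (p + 1) \<le> (cu * ?g n) ^ (p + 1)"
        using h[of n] by (intro power_mono) auto
      then show ?case unfolding power_mult_distrib gr[OF elim(2)] .
    qed
    show "\<forall>\<^sub>F n in sequentially. \<forall>i<n. C * cl \<le> N n i * h n * (r n)\<^sup>2"
      using cl(2) eventually_gt_at_top[of 0]
    proof eventually_elim
      case (elim n)
      show ?case
      proof (intro allI impI)
        fix i assume "i < n"
        have "C * cl = C * (real n powr \<delta> * (cl * ?g n)) * (r n)\<^sup>2"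
          using nr[OF elim(2)] by (simp add: mult_ac)
        also have "\<dots> \<le> C * (real n powr \<delta> * h n) * (r n)\<^sup>2"
          using elim(1) h[of n] C by (intro mult_right_mono mult_left_mono) auto
        also have "\<dots> \<le> N n i * h n * (r n)\<^sup>2"
          by (intro mult_right_mono Nh \<open>i < n\<close>) auto
        finally show "C * cl \<le> N n i * h n * (r n)\<^sup>2" .
      qed
    qed
    show "\<forall>\<^sub>F n in sequentially. \<forall>i<n. z \<le> N n i * h n" for z
      using filterlim_at_top[THEN iffD1, OF lim, rule_format, of "z / C"]
    proof eventually_elim
      case (elim n)
      then have "z \<le> C * (real n powr \<delta> * h n)" using C by (simp add: field_simps)
      then show ?case using Nh by (auto intro: order_trans)
    qed
  qed
qed

lemma subalgebra_design_algebra: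
  assumes "\<And>i j. (i, j) \<in> design_index N n \<Longrightarrow> \<tau> n i j \<in> borel_measurable M"
  shows "subalgebra M (design_algebra M N \<tau> n)"
    and "(i, j) \<in> design_index N n \<Longrightarrow> \<tau> n i j \<in> borel_measurable (design_algebra M N \<tau> n)"
proof -
  have meas: "design N \<tau> n \<in> measurable M (design_space N n)"
    unfolding design_def[abs_def] by (rule measurable_restrict) (use assms in auto)
  have "sets (design_algebra M N \<tau> n) \<subseteq> sets M"
    unfolding design_algebra_def by (rule sets_image_in_sets) (use meas in auto)
  then show "subalgebra M (design_algebra M N \<tau> n)"
    by (simp add: subalgebra_def design_algebra_def)
  have d: "design N \<tau> n \<in> measurable (design_algebra M N \<tau> n) (design_space N n)"
    unfolding design_algebra_def by (rule measurable_vimage_algebra1) (use measurable_space[OF meas] in auto)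
  assume ij: "(i, j) \<in> design_index N n"
  have "(\<lambda>\<omega>. design N \<tau> n \<omega> (i, j)) \<in> borel_measurable (design_algebra M N \<tau> n)"
    using measurable_compose[OF d measurable_component_singleton[OF ij]] .
  then show "\<tau> n i j \<in> borel_measurable (design_algebra M N \<tau> n)"
    using ij by (simp add: design_def)
qed

text \<open>
  All bounds are assumed on one interval \<open>{c..d}\<close>, which must contain the
  design points that fall into the windows around the points of \<open>S\<close>. It may be a compact part of the
  interior of \<open>{a..b}\<close> as well as the whole interval, since a window need not lie inside \<open>{c..d}\<close>; only its part
  in \<open>{a..b}\<close> matters.
\<close>

theorem lpk_expansion_on_window:
  fixes M :: "'w measure" and a b c d C \<delta> \<rho> \<pi>0 \<pi>1 s1 :: real
    and h :: "nat \<Rightarrow> real" and v \<epsilon> :: "nat \<Rightarrow> real \<Rightarrow> 'w \<Rightarrow> real"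
  assumes M: "prob_space M"
    and model: "functional_data_model M {a..b} v \<gamma> \<epsilon> \<sigma>2"
    and iid: "iid_design M \<pi> N \<tau>"
    and indep: "design_independent_of_processes M {a..b} \<eta> v \<epsilon> \<sigma>2 N \<tau>"
    and kernel: "kernel_condition K"
    and samp: "sampling_condition C \<delta> N h"
    and hrate: "h \<in> \<Theta>(\<lambda>n. real n powr (- \<delta> / (2 * real p + 3)))"
    and pdf: "is_pdf \<pi>" and outside: "\<And>x. x \<notin> {a..b} \<Longrightarrow> \<pi> x = 0"
    and cd: "a \<le> c" "c < d" "d \<le> b"
    and \<pi>0: "0 < \<pi>0" "\<And>x. x \<in> {c..d} \<Longrightarrow> \<pi>0 \<le> \<pi> x"
    and \<pi>1: "\<And>x. x \<in> {c..d} \<Longrightarrow> \<pi> x \<le> \<pi>1"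
    and s1: "0 \<le> s1" "\<And>x. x \<in> {c..d} \<Longrightarrow> \<sigma>2 x \<le> s1"
    and smooth: "\<And>i. AE \<omega> in M. times_cont_diff_on (p + 1) {c..d} (\<lambda>t. \<eta> t + v i t \<omega>)"
    and S: "S \<subseteq> {c..d}"
    and \<rho>: "0 < \<rho>" "\<And>t x. t \<in> S \<Longrightarrow> x \<in> {a..b} \<Longrightarrow> \<bar>x - t\<bar> \<le> \<rho> \<Longrightarrow> x \<in> {c..d}"
  shows "expansion_O_UP M S (lpk_reconstruction p K h N \<tau> \<eta> v \<epsilon>) (\<lambda>i t \<omega>. \<eta> t + v i t \<omega>)
          (\<lambda>n. real n powr (- ((real p + 1) * \<delta> / (2 * real p + 3))))"
proof -
  interpret prob_space M by (rule M)
  let ?F = "lpk_reconstruction p K h N \<tau> \<eta> v \<epsilon>"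
  let ?f = "\<lambda>i t \<omega>. \<eta> t + v i t \<omega>"
  define r where "r n = real n powr (- ((real p + 1) * \<delta> / (2 * real p + 3)))" for n
  define X where "X n i t \<omega> = (?F n i t \<omega> - ?f i t \<omega>) / r n" for n i t \<omega>
  let ?D = "\<lambda>n. design_algebra M N \<tau> n"
  have r_pos: "0 < r n" if "0 < n" for n using that by (simp add: r_def)
  have h_pos: "0 < h n" for n using samp by (simp add: sampling_condition_def)
  have h_lim: "h \<longlonglongrightarrow> 0" using samp by (simp add: sampling_condition_def)
  have pi_meas [measurable]: "\<pi> \<in> borel_measurable borel" and pi_nonneg: "\<And>x. 0 \<le> \<pi> x"
    using pdf by (auto simp: is_pdf_def)
  obtain B where K_meas [measurable]: "K \<in> borel_measurable borel"
    and K_nonneg: "\<And>u. 0 \<le> K u" and K_le: "\<And>u. K u \<le> B"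
    using kernel unfolding kernel_condition_def is_pdf_def by blast
  have v_meas: "\<And>i t. t \<in> {a..b} \<Longrightarrow> v i t \<in> borel_measurable M"
    and ident: "identically_distributed M {a..b} v"
    using model by (simp_all add: functional_data_model_def centered_process_with_cov_def)
  have \<tau>_distr: "distributed M lborel (\<tau> n i j) (\<lambda>x. ennreal (\<pi> x))" if "i < n" "j < N n i" for n i j
    using iid that by (auto simp: iid_design_def design_index_def)
  have \<tau>_indep: "indep_var borel (\<tau> n i j) borel (\<tau> n i k)" if "i < n" "j < N n i" "k < N n i" "j \<noteq> k" for n i j k
  proof -
    have "indep_vars (\<lambda>_. borel) (\<lambda>(i, j). \<tau> n i j) (design_index N n)"
      using iid by (simp add: iid_design_def)
    from indep_vars_imp_indep_var[OF this, of "(i, j)" "(i, k)"] that show ?thesis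
      by (simp add: design_index_def)
  qed
  have \<tau>_meas: "\<tau> n i j \<in> borel_measurable M" if "(i, j) \<in> design_index N n" for n i j
    using distributed_measurable[OF \<tau>_distr] that by (auto simp: design_index_def)
  have sub: "subalgebra M (?D n)" for n
    by (rule subalgebra_design_algebra(1)) (rule \<tau>_meas)
  have \<tau>_D: "\<tau> n i j \<in> borel_measurable (?D n)" if "i < n" "j < N n i" for n i j
    by (rule subalgebra_design_algebra(2)[OF \<tau>_meas]) (use that in \<open>simp_all add: design_index_def\<close>)
  have f_meas: "(\<lambda>\<omega>. \<eta> (\<tau> n i j \<omega>) + v i (\<tau> n i j \<omega>) \<omega>) \<in> borel_measurable M"
    and e_meas: "(\<lambda>\<omega>. \<epsilon> i (\<tau> n i j \<omega>) \<omega>) \<in> borel_measurable M"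
    and e_var: "AE \<omega> in M. nn_cond_exp M (?D n) (\<lambda>\<omega>. ennreal ((\<epsilon> i (\<tau> n i j \<omega>) \<omega>)\<^sup>2)) \<omega>
        = ennreal (\<sigma>2 (\<tau> n i j \<omega>))"
    and e_cov: "\<And>k. k < N n i \<Longrightarrow> j \<noteq> k \<Longrightarrow> AE \<omega> in M. real_cond_exp M (?D n)
        (\<lambda>\<omega>. \<epsilon> i (\<tau> n i j \<omega>) \<omega> * \<epsilon> i (\<tau> n i k \<omega>) \<omega>) \<omega> = noise_cov \<sigma>2 (\<tau> n i j \<omega>) (\<tau> n i k \<omega>)"
    if "i < n" "j < N n i" for n i j
  proof -
    have ij: "(i, j) \<in> design_index N n" using that by (simp add: design_index_def)
    note d = indep[unfolded design_independent_of_processes_def, THEN conjunct2]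
    note meas = d[THEN conjunct1, THEN spec, THEN bspec, OF ij, unfolded prod.case]
    note mom = d[THEN conjunct2, THEN spec, THEN bspec, OF ij, unfolded prod.case]
    from meas show "(\<lambda>\<omega>. \<eta> (\<tau> n i j \<omega>) + v i (\<tau> n i j \<omega>) \<omega>) \<in> borel_measurable M"
      "(\<lambda>\<omega>. \<epsilon> i (\<tau> n i j \<omega>) \<omega>) \<in> borel_measurable M" by simp_all
    from mom show "AE \<omega> in M. nn_cond_exp M (?D n) (\<lambda>\<omega>. ennreal ((\<epsilon> i (\<tau> n i j \<omega>) \<omega>)\<^sup>2)) \<omega>
        = ennreal (\<sigma>2 (\<tau> n i j \<omega>))" by (simp add: noise_cov_def)
    show "AE \<omega> in M. real_cond_exp M (?D n)
        (\<lambda>\<omega>. \<epsilon> i (\<tau> n i j \<omega>) \<omega> * \<epsilon> i (\<tau> n i k \<omega>) \<omega>) \<omega> = noise_cov \<sigma>2 (\<tau> n i j \<omega>) (\<tau> n i k \<omega>)"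
      if "k < N n i" "j \<noteq> k" for k using mom[THEN conjunct2, THEN conjunct2] that by auto
  qed
  have \<tau>_ab: "AE \<omega> in M. \<tau> n i j \<omega> \<in> {a..b}" if "i < n" "j < N n i" for n i j
  proof -
    have "0 < ennreal (\<pi> x) \<longrightarrow> x \<in> {a..b}" for x
      using outside[of x] by (cases "x \<in> {a..b}") simp_all
    then show ?thesis by (subst distributed_AE2[OF \<tau>_distr[OF that]]) simp_all
  qed
  have X_meas: "X n i t \<in> borel_measurable M" if "i < n" "t \<in> S" for n i t
  proof -
    have [measurable]: "v i t \<in> borel_measurable M" using that S cd by (intro v_meas) auto
    have \<tau>': "\<tau> n i j \<in> borel_measurable M" if "j < N n i" for j
      using \<tau>_meas \<open>i < n\<close> that by (simp add: design_index_def)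
    have term_meas: "(\<lambda>\<omega>. lpk_weight p K (h n) (N n i) (\<lambda>j. \<tau> n i j \<omega>) t j *
          (\<eta> (\<tau> n i j \<omega>) + v i (\<tau> n i j \<omega>) \<omega> + \<epsilon> i (\<tau> n i j \<omega>) \<omega>)) \<in> borel_measurable M"
      if "j < N n i" for j
      by (intro borel_measurable_times borel_measurable_lpk_weight[OF \<tau>' K_meas that]
            borel_measurable_add[OF f_meas e_meas] \<open>i < n\<close> that)
    have "(\<lambda>\<omega>. ?F n i t \<omega>) \<in> borel_measurable M"
      unfolding lpk_reconstruction_def lpk_eq_weighted_sum
      by (rule borel_measurable_sum) (use term_meas in simp)
    then show ?thesis unfolding X_def[abs_def] by measurable
  qed
  have tight: "\<exists>Bd. \<forall>\<^sub>F n in sequentially. \<forall>i<n. \<forall>t\<in>S. prob {\<omega> \<in> space M. \<bar>X n i t \<omega>\<bar> > Bd} \<le> e"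
    if e: "0 < e" for e :: real
  proof -
    obtain c0 where c0: "0 < c0" and half: "\<And>q I. I \<in> {{0..1}, {-1..0}} \<Longrightarrow>
       c0 * (\<Sum>k\<le>p. (q k)\<^sup>2) \<le> (\<integral>u. indicator I u * K u * (\<Sum>k\<le>p. q k * u ^ k)\<^sup>2 \<partial>lborel)"
      using kernel_half_form_coercive[OF kernel] by blast
    define \<kappa> where "\<kappa> = \<pi>0 * c0 / 2"
    have \<kappa>: "0 < \<kappa>" using \<pi>0 c0 by (simp add: \<kappa>_def)
    define w where "w = real (p + 1) * B / \<kappa>"
    have B0: "0 \<le> B" using K_nonneg[of 0] K_le[of 0] by linarith
    have w0: "0 \<le> w" using B0 \<kappa> by (simp add: w_def)
    have \<pi>1_pos: "0 < \<pi>1" using \<pi>0(1) \<pi>0(2)[of c] \<pi>1[of c] cd by simp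
    have e4: "0 < e / 4" using e by simp
    obtain L where L0: "0 \<le> L" and L: "\<forall>i. \<exists>E\<in>events. 1 - prob E \<le> e / 4 \<and>
       (\<forall>\<omega>\<in>E. \<forall>t\<in>{c..d}. \<exists>q. q 0 = ?f i t \<omega> \<and>
       (\<forall>x\<in>{c..d}. \<bar>?f i x \<omega> - (\<Sum>k\<le>p. q k * (x - t) ^ k)\<bar> \<le> L * \<bar>x - t\<bar> ^ (p + 1)))"
      using uniform_Taylor_bound[OF cd v_meas ident smooth e4] by blast
    obtain c1 c2 where c12: "0 < c1" "0 < c2"
      and h_le: "\<forall>\<^sub>F n in sequentially. h n ^ (p + 1) \<le> c2 * r n"
      and Nhr: "\<forall>\<^sub>F n in sequentially. \<forall>i<n. c1 \<le> N n i * h n * (r n)\<^sup>2"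
      and Nh: "\<And>z. \<forall>\<^sub>F n in sequentially. \<forall>i<n. z \<le> N n i * h n"
      using sampling_rates[OF samp hrate r_def] by blast
    \<comment> \<open>Each of the four exceptional events of the finite sample bound gets probability at most \<open>e / 4\<close>:
        \<open>T\<close> limits the number of design points in the window, \<open>Q1\<close> belongs to the empirical moments and
        \<open>Q2\<close> to the noise, whose threshold is \<open>R\<close> times the rate.\<close>
    define T where "T = 8 * \<pi>1 / e"
    have T: "0 < T" "2 * \<pi>1 / T = e / 4" using e \<pi>1_pos by (simp_all add: T_def)
    define Q1 where "Q1 = real (2 * p + 1) * (2 * B\<^sup>2 * \<pi>1 / (\<kappa> / real (p + 1))\<^sup>2)"
    define Q2 where "Q2 = 2 * \<pi>1 * w\<^sup>2 * s1"
    have Q: "0 \<le> Q1" "0 \<le> Q2" using \<pi>1_pos s1 by (simp_all add: Q1_def Q2_def)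
    define R where "R = 4 * Q2 / (e * c1) + 1"
    have R1: "1 \<le> R" using Q e c12 by (simp add: R_def)
    define Bd where "Bd = w * L * c2 * T + R"
    have h_small: "\<forall>\<^sub>F n in sequentially. h n < min \<rho> ((d - c) / 2)"
      using order_tendstoD(2)[OF h_lim, of "min \<rho> ((d - c) / 2)"] \<rho> cd by simp
    show ?thesis
    proof (intro exI[of _ Bd])
      show "\<forall>\<^sub>F n in sequentially. \<forall>i<n. \<forall>t\<in>S. prob {\<omega> \<in> space M. \<bar>X n i t \<omega>\<bar> > Bd} \<le> e"
        using h_le Nhr Nh[of "4 * Q1 / e"] Nh[of 1] h_small
      proof eventually_elim
        case (elim n)
        show ?case
        proof (intro allI impI ballI)
          fix i t assume i: "i < n" and t: "t \<in> S"
          have tcd: "t \<in> {c..d}" using t S by auto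
          have near: "x \<in> {c..d}" if "x \<in> {a..b}" "\<bar>x - t\<bar> \<le> h n" for x
            using \<rho>(2)[OF t that(1)] that(2) elim(5) by simp
          have rn: "0 < r n" using i by (intro r_pos) simp
          have Npos: "0 < N n i" 
          proof -
            have "1 \<le> N n i * h n" using elim(4) i by blast
            then show ?thesis by (cases "N n i") simp_all
          qed
          interpret W: windowed_sample M "N n i" "\<tau> n i" \<pi> K B \<pi>1 t "h n"
          proof unfold_locales
            show "\<pi> x \<le> \<pi>1" if "\<bar>x - t\<bar> \<le> h n" for x
              using near[of x] \<pi>1[of x] outside[of x] that \<pi>1_pos by (cases "x \<in> {a..b}") auto
            show "K u = 0" if "u \<notin> {-1..1}" for u by (rule kernel_vanishes_outside[OF kernel that])
          qed (fact Npos h_pos \<tau>_distr[OF i] \<tau>_indep[OF i] pi_meas pi_nonneg K_meas K_nonneg K_le)+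
          have coer: "2 * \<kappa> * (\<Sum>k\<le>p. (q k)\<^sup>2) \<le> (\<Sum>k\<le>p. \<Sum>l\<le>p. q k * q l * W.kernel_mean (k + l))" for q
          proof -
            \<comment> \<open>As \<open>h n < (d - c) / 2\<close>, at least one half of the window stays in \<open>{c..d}\<close>.\<close>
            define I :: "real set" where "I = (if t + h n \<le> d then {0..1} else {-1..0})"
            have "\<pi>0 \<le> \<pi> (t + h n * u)" if u: "u \<in> I" for u
            proof (rule \<pi>0(2))
              show "t + h n * u \<in> {c..d}"
              proof (cases "t + h n \<le> d")
                case True
                then have u: "0 \<le> u" "u \<le> 1" using u by (auto simp: I_def)
                then have "0 \<le> h n * u" "h n * u \<le> h n * 1" using h_pos[of n] by (auto intro: mult_left_mono)
                then show ?thesis using True tcd by auto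
              next
                case False
                then have u: "-1 \<le> u" "u \<le> 0" using u by (auto simp: I_def)
                then have "h n * u \<le> 0" "h n * (-1) \<le> h n * u"
                  using h_pos[of n] mult_left_mono[of "-1" u "h n"] by (auto simp: mult_le_0_iff)
                then show ?thesis using False tcd elim(5) by auto
              qed
            qed
            then have "\<pi>0 * c0 * (\<Sum>k\<le>p. (q k)\<^sup>2) \<le> (\<Sum>k\<le>p. \<Sum>l\<le>p. q k * q l * W.kernel_mean (k + l))"
              by (intro W.kernel_mean_coercive[where I = I] half) (use \<pi>0 in \<open>auto simp: I_def\<close>)
            then show ?thesis by (simp add: \<kappa>_def)
          qed
          obtain E where E: "E \<in> events" "1 - prob E \<le> e / 4" "\<And>\<omega>. \<omega> \<in> E \<Longrightarrow> \<exists>q. q 0 = ?f i t \<omega> \<and>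
              (\<forall>x\<in>{c..d}. \<bar>?f i x \<omega> - (\<Sum>k\<le>p. q k * (x - t) ^ k)\<bar> \<le> L * \<bar>x - t\<bar> ^ (p + 1))"
            using L[rule_format, of i] tcd by blast
          have ab_AE: "AE \<omega> in M. \<forall>j\<in>{..<N n i}. \<tau> n i j \<omega> \<in> {a..b}"
            by (subst AE_finite_all) (simp_all add: \<tau>_ab[OF i, simplified])
          obtain Nu where Nu: "\<And>\<omega>. \<omega> \<in> space M - Nu \<Longrightarrow> \<forall>j\<in>{..<N n i}. \<tau> n i j \<omega> \<in> {a..b}"
              "Nu \<in> null_sets M"
            by (rule AE_E3[OF ab_AE]) (rule that)
          let ?Dn = "L * h n ^ (p + 1)"
          have EN: "E - Nu \<in> events" "prob (E - Nu) = prob E"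
            using E(1) Nu(2) by (auto simp: measure_Diff_null_set)
          have taylor: "\<exists>q. q 0 = ?f i t \<omega> \<and> (\<forall>j<N n i. \<bar>\<tau> n i j \<omega> - t\<bar> \<le> h n \<longrightarrow>
              \<bar>?f i (\<tau> n i j \<omega>) \<omega> - (\<Sum>k\<le>p. q k * (\<tau> n i j \<omega> - t) ^ k)\<bar> \<le> ?Dn)"
            if \<omega>: "\<omega> \<in> E - Nu" for \<omega>
          proof -
            from E(3)[of \<omega>] \<omega> obtain q where q: "q 0 = ?f i t \<omega>"
              "\<And>x. x \<in> {c..d} \<Longrightarrow> \<bar>?f i x \<omega> - (\<Sum>k\<le>p. q k * (x - t) ^ k)\<bar> \<le> L * \<bar>x - t\<bar> ^ (p + 1)" by blast
            have "\<omega> \<in> space M - Nu" using \<omega> sets.sets_into_space[OF E(1)] by auto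
            note ab = Nu(1)[OF this]
            show ?thesis
            proof (intro exI[of _ q] conjI allI impI)
              fix j assume j: "j < N n i" "\<bar>\<tau> n i j \<omega> - t\<bar> \<le> h n"
              have "\<bar>?f i (\<tau> n i j \<omega>) \<omega> - (\<Sum>k\<le>p. q k * (\<tau> n i j \<omega> - t) ^ k)\<bar> \<le> L * \<bar>\<tau> n i j \<omega> - t\<bar> ^ (p + 1)"
                by (rule q(2)[OF near]) (use ab j in auto)
              also have "\<dots> \<le> ?Dn" using L0 j by (intro mult_left_mono power_mono) auto
              finally show "\<bar>?f i (\<tau> n i j \<omega>) \<omega> - (\<Sum>k\<le>p. q k * (\<tau> n i j \<omega> - t) ^ k)\<bar> \<le> ?Dn" .
            qed (rule q(1))
          qed
          let ?err = "\<lambda>\<omega>. ?F n i t \<omega> - ?f i t \<omega>"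
          have "prob {\<omega> \<in> space M. \<bar>?err \<omega>\<bar> > w * ?Dn * T + R * r n}
              \<le> (1 - prob (E - Nu)) + 2 * \<pi>1 / T + (Q1 + Q2 / (R * r n)\<^sup>2) / (N n i * h n)"
            unfolding lpk_reconstruction_def Q1_def Q2_def w_def
          proof (rule W.lpk_error_tail[where F = "?D n" and ?s2.0 = \<sigma>2 and E = "E - Nu"
                and f = "\<lambda>\<omega> x. ?f i x \<omega>" and e = "\<lambda>j \<omega>. \<epsilon> i (\<tau> n i j \<omega>) \<omega>"])
            show "AE \<omega> in M. \<bar>\<tau> n i j \<omega> - t\<bar> \<le> h n \<longrightarrow> \<sigma>2 (\<tau> n i j \<omega>) \<le> s1" if "j < N n i" for j
              using \<tau>_ab[OF i that] by (rule eventually_mono) (intro impI s1(2) near)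
            show "0 < R * r n" using R1 rn by simp
            show "0 \<le> ?Dn" using L0 h_pos[of n] by simp
          qed (fact \<kappa> coer sub \<tau>_D[OF i] e_meas[OF i] e_var[OF i] e_cov[OF i] s1(1) T(1) EN(1) taylor)+
          also have "\<dots> \<le> e / 4 + e / 4 + (e / 4 + e / 4)"
          proof -
            have Nhp: "0 < N n i * h n" using Npos h_pos[of n] by simp
            have "Q1 / (N n i * h n) \<le> e / 4"
              using elim(3) i e Nhp by (simp add: pos_divide_le_eq mult.commute)
            moreover have "Q2 / (R * r n)\<^sup>2 / (N n i * h n) \<le> e / 4"
            proof -
              have "Q2 / (R * r n)\<^sup>2 / (N n i * h n) = Q2 / (R\<^sup>2 * (N n i * h n * (r n)\<^sup>2))"
                by (simp add: power_mult_distrib mult_ac)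
              also have "\<dots> \<le> Q2 / (R * c1)"
              proof (rule divide_left_mono)
                have "R \<le> R\<^sup>2" using R1 by (simp add: power2_eq_square)
                then show "R * c1 \<le> R\<^sup>2 * (N n i * h n * (r n)\<^sup>2)"
                  using elim(2) i c12 R1 by (intro mult_mono) auto
                show "0 < R\<^sup>2 * (N n i * h n * (r n)\<^sup>2) * (R * c1)"
                  using R1 c12 rn Nhp by simp
              qed (rule Q(2))
              also have "\<dots> \<le> e / 4"
              proof -
                have "R * c1 * e = 4 * Q2 + c1 * e" using e c12 by (simp add: R_def field_simps)
                moreover have "0 < c1 * e" using c12 e by simp
                ultimately have "4 * Q2 \<le> e * (R * c1)" by (simp add: mult_ac)
                then show ?thesis using R1 c12 by (simp add: field_simps)
              qed
              finally show ?thesis .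
            qed
            ultimately show ?thesis using E(2) T(2) unfolding add_divide_distrib EN(2) by linarith
          qed
          finally have err: "prob {\<omega> \<in> space M. \<bar>?err \<omega>\<bar> > w * ?Dn * T + R * r n} \<le> e" by simp
          have X_err: "?err \<omega> = X n i t \<omega> * r n" for \<omega> using rn by (simp add: X_def)
          have "w * ?Dn * T + R * r n \<le> Bd * r n"
          proof -
            have "w * L * T * h n ^ (p + 1) \<le> w * L * T * (c2 * r n)"
              using elim(1) w0 L0 T by (intro mult_left_mono) auto
            then show ?thesis by (simp add: Bd_def algebra_simps)
          qed
          note Bd = this
          have sub': "{\<omega> \<in> space M. \<bar>X n i t \<omega>\<bar> > Bd} \<subseteq> {\<omega> \<in> space M. \<bar>?err \<omega>\<bar> > w * ?Dn * T + R * r n}"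
          proof safe
            fix \<omega> assume "Bd < \<bar>X n i t \<omega>\<bar>"
            then have "Bd * r n < \<bar>X n i t \<omega>\<bar> * r n" using rn by simp
            also have "\<dots> = \<bar>?err \<omega>\<bar>" unfolding X_err abs_mult using rn by simp
            finally show "w * ?Dn * T + R * r n < \<bar>?err \<omega>\<bar>" using Bd by simp
          qed
          have "{\<omega> \<in> space M. \<bar>X n i t \<omega> * r n\<bar> > w * ?Dn * T + R * r n} \<in> events"
            using X_meas[OF i t] by measurable
          then have meas: "{\<omega> \<in> space M. \<bar>?err \<omega>\<bar> > w * ?Dn * T + R * r n} \<in> events"
            unfolding X_err .
          show "prob {\<omega> \<in> space M. \<bar>X n i t \<omega>\<bar> > Bd} \<le> e"
            by (rule order_trans[OF finite_measure_mono[OF sub' meas] err])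
        qed
      qed
    qed
  qed
  show ?thesis unfolding expansion_O_UP_def
  proof (intro exI[of _ X] conjI allI impI ballI)
    show "O_UP_one M S X" unfolding O_UP_one_def
      by (intro conjI allI impI ballI X_meas tight)
    fix n i :: nat and t \<omega> assume "i < n"
    then have "r n \<noteq> 0" using r_pos[of n] by auto
    then show "?F n i t \<omega> = ?f i t \<omega> + real n powr (- ((real p + 1) * \<delta> / (2 * real p + 3))) * X n i t \<omega>"
      unfolding X_def r_def[symmetric] by simp
  qed
qed

lemma times_cont_diff_on_subset:
  assumes "times_cont_diff_on k R f" "R' \<subseteq> R"
  shows "times_cont_diff_on k R' f"
proof -
  from assms(1) obtain D where D: "\<And>t. t \<in> R \<Longrightarrow> D 0 t = f t"
    "\<And>l t. l < k \<Longrightarrow> t \<in> R \<Longrightarrow> (D l has_real_derivative D (Suc l) t) (at t within R)"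
    "\<And>l. l \<le> k \<Longrightarrow> continuous_on R (D l)"
    unfolding times_cont_diff_on_def by blast
  show ?thesis
    unfolding times_cont_diff_on_def
  proof (intro exI[of _ D] conjI allI impI ballI)
    fix l t assume "l < k" "t \<in> R'"
    then show "(D l has_real_derivative D (Suc l) t) (at t within R')"
      using D(2)[of l t] assms(2) by (intro DERIV_subset[OF _ assms(2)]) auto
  next
    fix l assume "l \<le> k"
    then show "continuous_on R' (D l)" by (intro continuous_on_subset[OF D(3) assms(2)])
  qed (use D(1) assms(2) in auto)
qed

text \<open>
  On a compact interval, continuity turns the pointwise conditions on the density and on the error
  variance into the uniform bounds needed for the finite sample estimates.
\<close>

lemma lpk_expansion_of_regularity:
  fixes M :: "'w measure" and a b c d C \<delta> \<rho> :: real
    and h :: "nat \<Rightarrow> real" and v \<epsilon> :: "nat \<Rightarrow> real \<Rightarrow> 'w \<Rightarrow> real"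
  assumes M: "prob_space M"
    and model: "functional_data_model M {a..b} v \<gamma> \<epsilon> \<sigma>2"
    and iid: "iid_design M \<pi> N \<tau>"
    and indep: "design_independent_of_processes M {a..b} \<eta> v \<epsilon> \<sigma>2 N \<tau>"
    and kernel: "kernel_condition K"
    and samp: "sampling_condition C \<delta> N h"
    and hrate: "h \<in> \<Theta>(\<lambda>n. real n powr (- \<delta> / (2 * real p + 3)))"
    and dens: "regular_design_density a b R \<pi>"
    and smooth: "smooth_functional_data M p a b R \<eta> v \<gamma> \<sigma>2"
    and cd: "a \<le> c" "c < d" "d \<le> b" "{c..d} \<subseteq> R"
    and S: "S \<subseteq> {c..d}"
    and \<rho>: "0 < \<rho>" "\<And>t x. t \<in> S \<Longrightarrow> x \<in> {a..b} \<Longrightarrow> \<bar>x - t\<bar> \<le> \<rho> \<Longrightarrow> x \<in> {c..d}"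
  shows "expansion_O_UP M S (lpk_reconstruction p K h N \<tau> \<eta> v \<epsilon>) (\<lambda>i t \<omega>. \<eta> t + v i t \<omega>)
          (\<lambda>n. real n powr (- ((real p + 1) * \<delta> / (2 * real p + 3))))"
proof -
  have sub: "{c..d} \<subseteq> {a..b}" and ne: "{c..d} \<noteq> {}" using cd(1-3) by auto
  from dens obtain \<pi>' where pdf: "is_pdf \<pi>" and outside: "\<And>x. x \<notin> {a..b} \<Longrightarrow> \<pi> x = 0"
    and pos: "\<And>t. t \<in> R \<Longrightarrow> 0 < \<pi> t"
    and deriv: "\<And>t. t \<in> R \<Longrightarrow> (\<pi> has_real_derivative \<pi>' t) (at t within {a..b})"
    unfolding regular_design_density_def by blast
  have "continuous_on {c..d} \<pi>"
    unfolding continuous_on_eq_continuous_within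
  proof
    fix x assume "x \<in> {c..d}"
    then have "(\<pi> has_real_derivative \<pi>' x) (at x within {c..d})"
      using DERIV_subset[OF deriv sub] cd(4) by blast
    then show "continuous (at x within {c..d}) \<pi>" by (rule DERIV_continuous)
  qed
  note \<pi>_cont = this
  obtain xm where xm: "xm \<in> {c..d}" "\<And>x. x \<in> {c..d} \<Longrightarrow> \<pi> xm \<le> \<pi> x"
    using continuous_attains_inf[OF compact_Icc ne \<pi>_cont] by blast
  obtain xM where xM: "\<And>x. x \<in> {c..d} \<Longrightarrow> \<pi> x \<le> \<pi> xM"
    using continuous_attains_sup[OF compact_Icc ne \<pi>_cont] by blast
  have "continuous_on {c..d} \<sigma>2"
    unfolding continuous_on_eq_continuous_within
  proof
    fix x assume "x \<in> {c..d}"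
    then have "continuous (at x within {a..b}) \<sigma>2"
      using smooth cd(4) unfolding smooth_functional_data_def by blast
    then show "continuous (at x within {c..d}) \<sigma>2" by (rule continuous_within_subset[OF _ sub])
  qed
  then obtain xs where xs: "\<And>x. x \<in> {c..d} \<Longrightarrow> \<sigma>2 x \<le> \<sigma>2 xs"
    using continuous_attains_sup[OF compact_Icc ne] by blast
  show ?thesis
  proof (rule lpk_expansion_on_window[OF M model iid indep kernel samp hrate pdf outside cd(1-3),
        where ?\<pi>0.0 = "\<pi> xm" and ?\<pi>1.0 = "\<pi> xM" and ?s1.0 = "max 0 (\<sigma>2 xs)" and \<rho> = \<rho>])
    show "0 < \<pi> xm" using pos xm(1) cd(4) by blast
    show "AE \<omega> in M. times_cont_diff_on (p + 1) {c..d} (\<lambda>t. \<eta> t + v i t \<omega>)" for i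
    proof -
      have "AE \<omega> in M. times_cont_diff_on (p + 1) R (\<lambda>t. \<eta> t + v i t \<omega>)"
        using smooth unfolding smooth_functional_data_def by simp
      then show ?thesis by (rule eventually_mono) (rule times_cont_diff_on_subset[OF _ cd(4)])
    qed
    show "x \<in> {c..d}" if "t \<in> S" "x \<in> {a..b}" "\<bar>x - t\<bar> \<le> \<rho>" for t x
      by (rule \<rho>(2)[OF that])
    show "\<sigma>2 x \<le> max 0 (\<sigma>2 xs)" if "x \<in> {c..d}" for x using xs[OF that] by simp
  qed (simp_all add: xm(2) xM S \<rho>(1))
qed

theorem theorem2:
  fixes M :: "'w measure"
    and a b C \<delta> :: real
    and p :: nat
    and \<eta> \<sigma>2 \<pi> K :: "real \<Rightarrow> real"
    and \<gamma> :: "real \<Rightarrow> real \<Rightarrow> real"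
    and v \<epsilon> :: "nat \<Rightarrow> real \<Rightarrow> 'w \<Rightarrow> real"
    and N :: "nat \<Rightarrow> nat \<Rightarrow> nat"
    and \<tau> :: "nat \<Rightarrow> nat \<Rightarrow> nat \<Rightarrow> 'w \<Rightarrow> real"
    and h :: "nat \<Rightarrow> real"
  assumes "prob_space M" and "a < b" and "odd p"
    and "functional_data_model M {a..b} v \<gamma> \<epsilon> \<sigma>2"
    and "iid_design M \<pi> N \<tau>"
    and "design_independent_of_processes M {a..b} \<eta> v \<epsilon> \<sigma>2 N \<tau>"
    and "regular_design_density a b {a<..<b} \<pi>"
    and "smooth_functional_data M p a b {a<..<b} \<eta> v \<gamma> \<sigma>2"
    and "kernel_condition K"
    and "sampling_condition C \<delta> N h"
    and "h \<in> \<Theta>(\<lambda>n. real n powr (- \<delta> / (2 * real p + 3)))"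
  shows
    \<comment> \<open>locally uniformly in the interior, and uniformly on the whole interior
        if the regularity extends to the endpoints\<close>
    "(\<forall>S. compact S \<and> S \<subseteq> {a<..<b} \<longrightarrow>
        expansion_O_UP M S (lpk_reconstruction p K h N \<tau> \<eta> v \<epsilon>) (\<lambda>i t \<omega>. \<eta> t + v i t \<omega>)
          (\<lambda>n. real n powr (- ((real p + 1) * \<delta> / (2 * real p + 3))))) \<and>
     (regular_design_density a b {a..b} \<pi> \<and> smooth_functional_data M p a b {a..b} \<eta> v \<gamma> \<sigma>2 \<longrightarrow>
        expansion_O_UP M {a<..<b} (lpk_reconstruction p K h N \<tau> \<eta> v \<epsilon>) (\<lambda>i t \<omega>. \<eta> t + v i t \<omega>)
          (\<lambda>n. real n powr (- ((real p + 1) * \<delta> / (2 * real p + 3)))))"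
proof (intro conjI allI impI)
  note expansion = lpk_expansion_of_regularity[OF assms(1,4-6,9-11)]
  fix S assume "compact S \<and> S \<subseteq> {a<..<b}"
  then have S: "compact S" "S \<subseteq> {a<..<b}" by auto
  have "\<exists>c0 d0. a < c0 \<and> c0 \<le> d0 \<and> d0 < b \<and> S \<subseteq> {c0..d0}"
  proof (cases "S = {}")
    case True
    obtain s where "a < s" "s < b" using dense[OF \<open>a < b\<close>] by blast
    then show ?thesis using True by (intro exI[of _ s]) simp
  next
    case False
    obtain s0 where s0: "s0 \<in> S" "\<forall>s\<in>S. s0 \<le> s" using compact_attains_inf[OF S(1) False] by blast
    obtain s1 where s1: "s1 \<in> S" "\<forall>s\<in>S. s \<le> s1" using compact_attains_sup[OF S(1) False] by blast
    have "a < s0" "s0 \<le> s1" "s1 < b" "S \<subseteq> {s0..s1}" using s0 s1 S(2) by auto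
    then show ?thesis by blast
  qed
  then obtain c0 d0 where cd0: "a < c0" "c0 \<le> d0" "d0 < b" "S \<subseteq> {c0..d0}" by blast
  \<comment> \<open>Half of the distance to the endpoints: enlarged by \<open>\<rho>\<close>, the hull of \<open>S\<close> still lies in the interior.\<close>
  define \<rho> where "\<rho> = min (c0 - a) (b - d0) / 2"
  have "0 < \<rho>" "\<rho> \<le> (c0 - a) / 2" "\<rho> \<le> (b - d0) / 2" using cd0 by (auto simp: \<rho>_def)
  then have \<rho>: "0 < \<rho>" "a < c0 - \<rho>" "d0 + \<rho> < b" using cd0(1,3) by simp_all
  show "expansion_O_UP M S (lpk_reconstruction p K h N \<tau> \<eta> v \<epsilon>) (\<lambda>i t \<omega>. \<eta> t + v i t \<omega>)
          (\<lambda>n. real n powr (- ((real p + 1) * \<delta> / (2 * real p + 3))))"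
  proof (rule expansion[OF assms(7,8), where c = "c0 - \<rho>" and d = "d0 + \<rho>" and \<rho> = \<rho>])
    show "x \<in> {c0 - \<rho>..d0 + \<rho>}" if "t \<in> S" "\<bar>x - t\<bar> \<le> \<rho>" for t x
    proof -
      have "c0 \<le> t" "t \<le> d0" using that(1) cd0(4) by auto
      then show ?thesis using that(2) by (auto simp: abs_le_iff)
    qed
    show "S \<subseteq> {c0 - \<rho>..d0 + \<rho>}" using cd0(4) \<rho>(1) by force
  qed (use cd0(1-3) \<rho> in auto)
next
  note expansion = lpk_expansion_of_regularity[OF assms(1,4-6,9-11)]
  assume "regular_design_density a b {a..b} \<pi> \<and> smooth_functional_data M p a b {a..b} \<eta> v \<gamma> \<sigma>2"
  then have closed: "regular_design_density a b {a..b} \<pi>" "smooth_functional_data M p a b {a..b} \<eta> v \<gamma> \<sigma>2"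
    by simp_all
  show "expansion_O_UP M {a<..<b} (lpk_reconstruction p K h N \<tau> \<eta> v \<epsilon>) (\<lambda>i t \<omega>. \<eta> t + v i t \<omega>)
          (\<lambda>n. real n powr (- ((real p + 1) * \<delta> / (2 * real p + 3))))"
    by (rule expansion[OF closed, where c = a and d = b and \<rho> = 1]) (use \<open>a < b\<close> in auto)
qed

end
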